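(* Fix a positive integer $d$ and a real number $\epsilon\in(0,1)$. For each positive integer $h$, let $M=M(h)$ be an integer with $2\leq M$ and $M(h)=o(h/\log h)$, and set $r^*=r^*(h):=\sqrt{d}/(2h)$. Let $r=r(h)>0$ and consider the random geometric graph sequence $\widehat{\mathcal{G}}(r,d)=(G_n)_{n\geq 1}$. Let $\mathcal{E}_h$ be the event that every balanced $M$-tree $T$ of height $h$ appears as a subgraph of $G_{|T|}$, and let $\mathcal{F}_h$ be the event that for every balanced $M$-tree $T$ of height $h$, the graph $G_{|T|}$ does not contain $T$ as a subgraph. Then: (i) if $r\leq(1-\epsilon)r^*$, then $\mathbb{P}[\mathcal{F}_h]\to 1$ as $h\to\infty$; (ii) if $r\geq(1+\epsilon)r^*$, then $\mathbb{P}[\mathcal{E}_h]\to 1$ as $h\to\infty$.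
   Context: For a finite set $\mathcal{X}\subseteq[0,1]^d$, the geometric graph $G(\mathcal{X},r,d)$ has vertex set $\mathcal{X}$ and edges $xy$ for distinct $x,y\in\mathcal{X}$ with Euclidean distance $\lVert x-y\rVert\leq r$. Let $(X_i)_{i\geq1}$ be independent uniform random points in $[0,1]^d$; the random geometric graph sequence is $\widehat{\mathcal{G}}(r,d)=(G_n)_{n\geq1}$ with $G_n=G(\{X_1,\dots,X_n\},r,d)$. $|T|$ denotes the number of vertices of $T$. For a rooted tree, the layer $V_i$ is the set of vertices at graph distance $i$ from the root, the height is the largest $h$ with $V_h$ nonempty, and the children of a vertex in $V_j$ are its neighbours in $V_{j+1}$. Given positive integers $h$ and $(s_i)_{i=1}^h$, the balanced tree over $(s_i)_{i=1}^h$ is the rooted tree of height $h$ in which, for each $i\in\{1,\dots,h\}$, every vertex of $V_{i-1}$ has exactly $s_i$ children. A balanced $M$-tree of height $h$ is a balanced tree over a sequence $(s_i)_{i=1}^h$ with $s_i\in\{2,\dots,M\}$ for all $i$. *)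

theory Defs
  imports "HOL-Probability.Probability" "HOL-Library.Landau_Symbols"
begin

definition unit_cube :: "(real^'d) set" where
  "unit_cube = {x. \<forall>i. 0 \<le> x $ i \<and> x $ i \<le> 1}"

text \<open>Probability space of an i.i.d. sequence of uniform points X_0, X_1, ...
  (the paper's X_{i+1} is omega i).\<close>
definition rgg_space :: "(nat \<Rightarrow> real^'d) measure" where
  "rgg_space = (\<Pi>\<^sub>M i\<in>(UNIV::nat set). uniform_measure lborel (unit_cube :: (real^'d) set))"

definition geo_adj :: "real \<Rightarrow> real^'d \<Rightarrow> real^'d \<Rightarrow> bool" where
  "geo_adj r x y \<longleftrightarrow> x \<noteq> y \<and> dist x y \<le> r"

definition has_subgraph :: "'b set \<Rightarrow> ('b \<Rightarrow> 'b \<Rightarrow> bool) \<Rightarrow> 'c set \<Rightarrow> ('c \<Rightarrow> 'c \<Rightarrow> bool) \<Rightarrow> bool" where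
  "has_subgraph V E W A \<longleftrightarrow>
     (\<exists>f. inj_on f V \<and> f ` V \<subseteq> W \<and> (\<forall>u\<in>V. \<forall>v\<in>V. E u v \<longrightarrow> A (f u) (f v)))"

text \<open>Balanced tree over (s_1,...,s_h): vertices are words xs of length at most h with
  xs!j < s (j+1); the root is [], layer V_i is the words of length i, and the children of u
  are u@[c].\<close>
definition bt_verts :: "(nat \<Rightarrow> nat) \<Rightarrow> nat \<Rightarrow> nat list set" where
  "bt_verts s h = {xs. length xs \<le> h \<and> (\<forall>j<length xs. xs ! j < s (Suc j))}"

definition bt_adj :: "nat list \<Rightarrow> nat list \<Rightarrow> bool" where
  "bt_adj u v \<longleftrightarrow> (\<exists>c. v = u @ [c] \<or> u = v @ [c])"

definition balanced_M_seq :: "nat \<Rightarrow> nat \<Rightarrow> (nat \<Rightarrow> nat) \<Rightarrow> bool" where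
  "balanced_M_seq M h s \<longleftrightarrow> (\<forall>i\<in>{1..h}. 2 \<le> s i \<and> s i \<le> M)"

definition rgg_contains :: "real \<Rightarrow> (nat \<Rightarrow> real^'d) \<Rightarrow> nat \<Rightarrow> (nat \<Rightarrow> nat) \<Rightarrow> nat \<Rightarrow> bool" where
  "rgg_contains r \<omega> n s h \<longleftrightarrow> has_subgraph (bt_verts s h) bt_adj (\<omega> ` {..<n}) (geo_adj r)"

definition event_E :: "real \<Rightarrow> nat \<Rightarrow> nat \<Rightarrow> (nat \<Rightarrow> real^'d) set" where
  "event_E r M h = {\<omega> \<in> space rgg_space. \<forall>s. balanced_M_seq M h s \<longrightarrow>
      rgg_contains r \<omega> (card (bt_verts s h)) s h}"

definition event_F :: "real \<Rightarrow> nat \<Rightarrow> nat \<Rightarrow> (nat \<Rightarrow> real^'d) set" where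
  "event_F r M h = {\<omega> \<in> space rgg_space. \<forall>s. balanced_M_seq M h s \<longrightarrow>
      \<not> rgg_contains r \<omega> (card (bt_verts s h)) s h}"

end

theory Submission
  imports Defs "HOL-Real_Asymp.Real_Asymp"
begin

text \<open>
  Since \<open>T\<close> has as many vertices as the graph, an embedding of \<open>T\<close> is spanning.  Below the threshold it is
  impossible: all points would lie within \<open>h * r < sqrt d / 2\<close> of the image of the root, while every
  point of the cube is at distance at least \<open>sqrt d / 2\<close> from some corner, and all corners have points
  nearby.

  Above the threshold, cut the cube into \<open>k ^ d\<close> cells of side \<open>1 / k\<close> with \<open>k\<close> proportional to \<open>h\<close>, ordered
  along a snake so that consecutive cells touch.  As \<open>T\<close> has at least \<open>2 ^ h\<close> vertices, Hoeffding's
  inequality makes the number of points in every initial segment of the order nearly proportional,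
  simultaneously for all sizes \<open>n \<ge> 2 ^ h\<close>.  With \<open>j\<close> about \<open>\<epsilon> h / 8\<close>, the first \<open>j\<close> layers of \<open>T\<close> are put at
  the centre of the cube; the subtrees hanging from layer \<open>j\<close>, all isomorphic, are distributed evenly over the
  cells, the next \<open>h - 2 j\<close> layers walking in a straight line from the centre to the target cell.
  These layers make up a fraction at most \<open>2 ^ - j\<close> of \<open>T\<close> and so fit greedily.  The vertices of the last
  \<open>j\<close> layers and the remaining points are then matched monotonically along the snake, which moves no
  vertex further than to a cell next to its target.
\<close>

subsection \<open>Matchings, snake orders and balanced trees\<close>

text \<open>The inequalities say that the label distributions of \<open>A\<close> and
  \<open>B\<close> interleave up to a shift by one. Pairing an element of largest label in
  \<open>A\<close> with one in \<open>B\<close> respects the tolerance and leaves a smaller instance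
  of the same problem.\<close>

lemma monotone_matching:
  fixes \<alpha> :: "'a \<Rightarrow> nat" and \<beta> :: "'b \<Rightarrow> nat"
  assumes "finite A" "finite B" "card A = card B"
    and "\<And>i. card {a\<in>A. \<alpha> a \<le> i} \<le> card {b\<in>B. \<beta> b \<le> Suc i}"
    and "\<And>i. card {b\<in>B. \<beta> b \<le> i} \<le> card {a\<in>A. \<alpha> a \<le> Suc i}"
  shows "\<exists>g. bij_betw g A B \<and> (\<forall>a\<in>A. \<beta> (g a) \<le> Suc (\<alpha> a) \<and> \<alpha> a \<le> Suc (\<beta> (g a)))"
  using assms
proof (induction "card A" arbitrary: A B)
  case 0
  then show ?case by (auto intro!: exI[of _ undefined] simp: bij_betw_def)
next
  case (Suc n)
  have ne: "A \<noteq> {}" "B \<noteq> {}" using Suc.hyps(2) Suc.prems(3) by auto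
  obtain a where a: "a \<in> A" "\<And>x. x \<in> A \<Longrightarrow> \<alpha> x \<le> \<alpha> a"
    using Max_in[of "\<alpha> ` A"] Max_ge[of "\<alpha> ` A"] ne Suc.prems(1) by fastforce
  obtain b where b: "b \<in> B" "\<And>x. x \<in> B \<Longrightarrow> \<beta> x \<le> \<beta> b"
    using Max_in[of "\<beta> ` B"] Max_ge[of "\<beta> ` B"] ne Suc.prems(2) by fastforce
  have "{x\<in>A. \<alpha> x \<le> \<alpha> a} = A" using a by auto
  then have "card B \<le> card {x\<in>B. \<beta> x \<le> Suc (\<alpha> a)}" using Suc.prems(3) Suc.prems(4)[of "\<alpha> a"] by simp
  then have "{x\<in>B. \<beta> x \<le> Suc (\<alpha> a)} = B" using Suc.prems(2) by (intro card_seteq) auto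
  then have ba: "\<beta> b \<le> Suc (\<alpha> a)" using b(1) by auto
  have "{x\<in>B. \<beta> x \<le> \<beta> b} = B" using b by auto
  then have "card A \<le> card {x\<in>A. \<alpha> x \<le> Suc (\<beta> b)}" using Suc.prems(3) Suc.prems(5)[of "\<beta> b"] by simp
  then have "{x\<in>A. \<alpha> x \<le> Suc (\<beta> b)} = A" using Suc.prems(1) by (intro card_seteq) auto
  then have ab: "\<alpha> a \<le> Suc (\<beta> b)" using a(1) by auto
  have eqs: "{x\<in>A - {a}. \<alpha> x \<le> i} = {x\<in>A. \<alpha> x \<le> i} - {a}" 
     "{x\<in>B - {b}. \<beta> x \<le> i} = {x\<in>B. \<beta> x \<le> i} - {b}" for i by auto
  \<comment> \<open>Removing a maximal element lowers exactly those counts that were full. A count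
    that stops short of the maximal label is at most the full count minus one (\<open>ltA\<close>,
    \<open>ltB\<close>), so both families of inequalities survive.\<close>
  have cA: "card {x\<in>A - {a}. \<alpha> x \<le> i} = (if \<alpha> a \<le> i then card A - 1 else card {x\<in>A. \<alpha> x \<le> i})" for i
  proof (cases "\<alpha> a \<le> i")
    case True
    have "{x\<in>A - {a}. \<alpha> x \<le> i} = A - {a}" using True a(2) by (auto intro: order_trans)
    then show ?thesis using True a(1) Suc.prems(1) by simp
  next
    case False
    have "{x\<in>A - {a}. \<alpha> x \<le> i} = {x\<in>A. \<alpha> x \<le> i}" using False by auto
    then show ?thesis using False by simp
  qed
  have cB: "card {x\<in>B - {b}. \<beta> x \<le> i} = (if \<beta> b \<le> i then card B - 1 else card {x\<in>B. \<beta> x \<le> i})" for i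
  proof (cases "\<beta> b \<le> i")
    case True
    have "{x\<in>B - {b}. \<beta> x \<le> i} = B - {b}" using True b(2) by (auto intro: order_trans)
    then show ?thesis using True b(1) Suc.prems(2) by simp
  next
    case False
    have "{x\<in>B - {b}. \<beta> x \<le> i} = {x\<in>B. \<beta> x \<le> i}" using False by auto
    then show ?thesis using False by simp
  qed
  have ltA: "card {x\<in>A. \<alpha> x \<le> i} \<le> card A - 1" if "\<not> \<alpha> a \<le> i" for i
  proof -
    have "card {x\<in>A. \<alpha> x \<le> i} < card A" using a(1) that Suc.prems(1) by (intro psubset_card_mono) auto
    then show ?thesis by simp
  qed
  have ltB: "card {x\<in>B. \<beta> x \<le> i} \<le> card B - 1" if "\<not> \<beta> b \<le> i" for i
  proof -
    have "card {x\<in>B. \<beta> x \<le> i} < card B" using b(1) that Suc.prems(2) by (intro psubset_card_mono) auto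
    then show ?thesis by simp
  qed
  have "\<exists>g. bij_betw g (A - {a}) (B - {b}) \<and> (\<forall>x\<in>A - {a}. \<beta> (g x) \<le> Suc (\<alpha> x) \<and> \<alpha> x \<le> Suc (\<beta> (g x)))"
  proof (rule Suc.hyps(1))
    show "n = card (A - {a})" using Suc.hyps(2) a(1) by simp
    show "finite (A - {a})" "finite (B - {b})" using Suc.prems by auto
    show "card (A - {a}) = card (B - {b})" using Suc.prems a(1) b(1) by simp
    show "card {x\<in>A - {a}. \<alpha> x \<le> i} \<le> card {x\<in>B - {b}. \<beta> x \<le> Suc i}" for i
      unfolding cA cB using ltA[of i] ba Suc.prems(3) Suc.prems(4)[of i] by auto
    show "card {x\<in>B - {b}. \<beta> x \<le> i} \<le> card {x\<in>A - {a}. \<alpha> x \<le> Suc i}" for i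
      unfolding cA cB using ltB[of i] ab Suc.prems(3) Suc.prems(5)[of i] by auto
  qed
  then obtain g where g: "bij_betw g (A - {a}) (B - {b})"
     "\<forall>x\<in>A - {a}. \<beta> (g x) \<le> Suc (\<alpha> x) \<and> \<alpha> x \<le> Suc (\<beta> (g x))" by blast
  have "bij_betw (g(a := b)) A B"
    using g(1) a(1) b(1) unfolding bij_betw_def inj_on_def by (auto simp: image_iff)
  then show ?case using g(2) ba ab by (intro exI[of _ "g(a := b)"]) auto
qed

lemma inj_lifting:
  assumes "finite A" "finite B" "\<And>a. a \<in> A \<Longrightarrow> card A \<le> card {b\<in>B. \<sigma> b = \<psi> a}"
  shows "\<exists>f. inj_on f A \<and> f ` A \<subseteq> B \<and> (\<forall>a\<in>A. \<sigma> (f a) = \<psi> a)"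
  using assms(1,3)
proof (induction A rule: finite_induct)
  case (insert x F)
  have "card F \<le> card {b\<in>B. \<sigma> b = \<psi> a}" if "a \<in> F" for a
    using insert.prems[of a] insert.hyps that by simp
  then obtain f where f: "inj_on f F" "f ` F \<subseteq> B" "\<forall>a\<in>F. \<sigma> (f a) = \<psi> a"
    using insert.IH by blast
  have "card (f ` F) < card {b\<in>B. \<sigma> b = \<psi> x}"
    using insert.prems[of x] insert.hyps card_image[OF f(1)] by simp
  then have "\<not> {b\<in>B. \<sigma> b = \<psi> x} \<subseteq> f ` F"
    using card_mono[of "f ` F"] insert.hyps by (meson finite_imageI leD)
  then obtain b where b: "b \<in> B" "\<sigma> b = \<psi> x" "b \<notin> f ` F" by auto
  show ?case
    using f b insert.hyps
    by (intro exI[of _ "f(x := b)"]) (auto simp: inj_on_def)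
qed auto

text \<open>The slices with a fixed value in the new coordinate are traversed alternately forwards
  and backwards, so that only this coordinate changes between slices. Coordinates outside
  \<open>D\<close> are pinned to 0, which makes the empty case a one-element list.\<close>

lemma snake_order:
  assumes k: "k > 0" and "finite D"
  shows "\<exists>xs. distinct xs \<and> set xs = {f :: 'i \<Rightarrow> nat. (\<forall>i\<in>D. f i < k) \<and> (\<forall>i. i \<notin> D \<longrightarrow> f i = 0)}
    \<and> successively (\<lambda>f g. \<forall>i. f i \<le> Suc (g i) \<and> g i \<le> Suc (f i)) xs"
  using assms(2)
proof (induction D rule: finite_induct)
  case empty
  have "{f :: 'i \<Rightarrow> nat. (\<forall>i\<in>{}. f i < k) \<and> (\<forall>i. i \<notin> {} \<longrightarrow> f i = 0)} = {\<lambda>_. 0}" by auto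
  then show ?case by (intro exI[of _ "[\<lambda>_. 0]"]) auto
next
  case (insert a D)
  let ?S = "{f :: 'i \<Rightarrow> nat. (\<forall>i\<in>D. f i < k) \<and> (\<forall>i. i \<notin> D \<longrightarrow> f i = 0)}"
  let ?R = "\<lambda>(f::'i \<Rightarrow> nat) g. \<forall>i. f i \<le> Suc (g i) \<and> g i \<le> Suc (f i)"
  obtain L where L: "distinct L" "set L = ?S" "successively ?R L" using insert.IH by blast
  have "(\<lambda>_. 0) \<in> set L" unfolding L(2) using k by auto
  then have Lne: "L \<noteq> []" by auto
  have Lrev: "successively ?R (rev L)"
    unfolding successively_rev by (rule successively_mono[OF L(3)]) auto
  define blk where "blk v = map (\<lambda>f. f(a := v)) (if even v then L else rev L)" for v :: nat
  have blk_ne: "blk v \<noteq> []" for v using Lne by (simp add: blk_def)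
  have set_blk: "set (blk v) = (\<lambda>f. f(a := v)) ` ?S" for v by (simp add: blk_def L(2))
  have blk_dist: "distinct (blk v)" for v
  proof -
    have "inj_on (\<lambda>f. f(a := v)) ?S"
    proof (rule inj_onI)
      fix f g :: "'i \<Rightarrow> nat"
      assume "f \<in> ?S" "g \<in> ?S" "f(a := v) = g(a := v)"
      then show "f = g" using insert.hyps(2)
        by (metis (mono_tags, lifting) fun_upd_triv fun_upd_upd mem_Collect_eq)
    qed
    then show ?thesis unfolding blk_def by (auto simp: distinct_map L)
  qed
  have blk_succ: "successively ?R (blk v)" for v
    unfolding blk_def successively_map using L(3) Lrev
    by (auto elim!: successively_mono)
  have join: "?R (last (blk v)) (hd (blk (Suc v)))" for v
    using Lne by (auto simp: blk_def last_map hd_map hd_rev last_rev)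
  \<comment> \<open>The last element is carried along because the next block is joined to
    it.\<close>
  have "\<exists>ys. distinct ys \<and> set ys = (\<Union>w\<in>{..v}. set (blk w)) \<and> successively ?R ys
     \<and> ys \<noteq> [] \<and> last ys = last (blk v)" for v
  proof (induction v)
    case 0
    show ?case using blk_ne blk_succ blk_dist by (intro exI[of _ "blk 0"]) auto
  next
    case (Suc v)
    then obtain ys where ys: "distinct ys" "set ys = (\<Union>w\<in>{..v}. set (blk w))" "successively ?R ys"
      "ys \<noteq> []" "last ys = last (blk v)" by blast
    have "set ys \<inter> set (blk (Suc v)) = {}"
      unfolding ys(2) set_blk by (auto simp: fun_eq_iff dest!: spec[of _ a])
    then have "distinct (ys @ blk (Suc v))" using ys(1) blk_dist by simp
    moreover have "successively ?R (ys @ blk (Suc v))"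
      unfolding successively_append_iff using ys(3,5) blk_succ join[of v] by simp
    moreover have "set (ys @ blk (Suc v)) = (\<Union>w\<in>{..Suc v}. set (blk w))"
      using ys(2) by (auto simp: atMost_Suc)
    ultimately show ?case using blk_ne[of "Suc v"] by (intro exI[of _ "ys @ blk (Suc v)"]) auto
  qed
  then obtain ys where ys: "distinct ys" "set ys = (\<Union>w\<in>{..k-1}. set (blk w))" "successively ?R ys" by blast
  have "set ys = {f :: 'i \<Rightarrow> nat. (\<forall>i\<in>insert a D. f i < k) \<and> (\<forall>i. i \<notin> insert a D \<longrightarrow> f i = 0)}" (is "_ = ?T")
  proof (intro equalityI subsetI)
    fix f assume "f \<in> set ys"
    then show "f \<in> ?T" unfolding ys(2) set_blk using k by (auto simp: less_Suc_eq_le)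
  next
    fix f assume f: "f \<in> ?T"
    then have "f = (f(a := 0))(a := f a)" "f(a := 0) \<in> ?S" "f a \<in> {..k-1}" using insert.hyps(2) by auto
    then show "f \<in> set ys" unfolding ys(2) set_blk by blast
  qed
  with ys show ?case by blast
qed

section \<open>Sizes of balanced trees, their layers and their hanging subtrees\<close>

lemma finite_bt_verts: "finite (bt_verts s h)"
proof (rule finite_subset)
  show "bt_verts s h \<subseteq> {xs. set xs \<subseteq> {..<(\<Sum>i\<le>h. s i)} \<and> length xs \<le> h}"
  proof (clarsimp simp: bt_verts_def in_set_conv_nth subset_iff)
    fix xs :: "nat list" and j
    assume "length xs \<le> h" "\<forall>j<length xs. xs ! j < s (Suc j)" "j < length xs"
    then have "xs ! j < s (Suc j)" "Suc j \<in> {..h}" by auto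
    then show "xs ! j < (\<Sum>i\<le>h. s i)"
      using member_le_sum[of "Suc j" "{..h}" s] by (meson finite_atMost le0 less_le_trans)
  qed
  show "finite {xs. set xs \<subseteq> {..<(\<Sum>i\<le>h. s i)} \<and> length xs \<le> h}"
    by (intro finite_lists_length_le) auto
qed

lemma Nil_in_bt_verts [simp]: "[] \<in> bt_verts s h"
  by (simp add: bt_verts_def)

lemma bt_verts_snoc_D: "v @ [c] \<in> bt_verts s h \<Longrightarrow> v \<in> bt_verts s h"
  by (fastforce simp: bt_verts_def nth_append less_Suc_eq)

lemma bt_verts_snoc_iff:
  "v @ [c] \<in> bt_verts s (Suc l) \<longleftrightarrow> v \<in> bt_verts s l \<and> c < s (Suc (length v))"
  by (auto simp: bt_verts_def nth_append less_Suc_eq)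

text \<open>Every vertex of the lower tree, not only a leaf, can be extended by 0 and by 1 inside
  the higher tree, and all these words are distinct.\<close>

lemma card_bt_verts_Suc:
  assumes "\<And>i. i \<in> {1..Suc l} \<Longrightarrow> 2 \<le> s i"
  shows "2 * card (bt_verts s l) \<le> card (bt_verts s (Suc l))"
proof -
  let ?f = "\<lambda>(v, c). v @ [c]"
  have "?f ` (bt_verts s l \<times> {..<2}) \<subseteq> bt_verts s (Suc l)"
  proof clarsimp
    fix v and c :: nat assume v: "v \<in> bt_verts s l" "c < 2"
    then have "2 \<le> s (Suc (length v))" using assms by (auto simp: bt_verts_def)
    then show "v @ [c] \<in> bt_verts s (Suc l)" using v by (simp add: bt_verts_snoc_iff)
  qed
  then have "card (bt_verts s l \<times> {..<2::nat}) \<le> card (bt_verts s (Suc l))"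
    by (intro card_inj_on_le[where f = ?f] finite_bt_verts) (auto simp: inj_on_def)
  then show ?thesis by (simp add: card_cartesian_product)
qed

lemma card_bt_verts_mono_power:
  assumes "\<And>i. i \<in> {1..l + t} \<Longrightarrow> 2 \<le> s i"
  shows "2 ^ t * card (bt_verts s l) \<le> card (bt_verts s (l + t))"
  using assms
proof (induction t)
  case (Suc t)
  have "2 ^ t * card (bt_verts s l) \<le> card (bt_verts s (l + t))" using Suc by auto
  moreover have "2 * card (bt_verts s (l + t)) \<le> card (bt_verts s (Suc (l + t)))"
    using Suc.prems by (intro card_bt_verts_Suc) auto
  ultimately show ?case by simp
qed simp

lemma power2_le_card_bt_verts:
  assumes "\<And>i. i \<in> {1..h} \<Longrightarrow> 2 \<le> s i"
  shows "2 ^ h \<le> card (bt_verts s h)"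
proof -
  have "bt_verts s 0 = {[]}" by (auto simp: bt_verts_def)
  then show ?thesis using card_bt_verts_mono_power[of 0 h s] assms by simp
qed

definition bt_layer :: "(nat \<Rightarrow> nat) \<Rightarrow> nat \<Rightarrow> nat list set" where
  "bt_layer s j = {w. length w = j \<and> (\<forall>i<j. w ! i < s (Suc i))}"

lemma finite_bt_layer: "finite (bt_layer s j)"
  by (rule finite_subset[OF _ finite_bt_verts[of s j]]) (auto simp: bt_layer_def bt_verts_def)

lemma power2_le_card_bt_layer:
  assumes "\<And>i. i \<in> {1..j} \<Longrightarrow> 2 \<le> s i"
  shows "2 ^ j \<le> card (bt_layer s j)"
  using assms
proof (induction j)
  case 0
  have "bt_layer s 0 = {[]}" by (auto simp: bt_layer_def)
  then show ?case by simp
next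
  case (Suc j)
  let ?f = "\<lambda>(v, c). v @ [c]"
  have "2 \<le> s (Suc j)" using Suc.prems by auto
  then have "?f ` (bt_layer s j \<times> {..<2}) \<subseteq> bt_layer s (Suc j)"
    by (auto simp: bt_layer_def nth_append less_Suc_eq)
  then have "card (bt_layer s j \<times> {..<2::nat}) \<le> card (bt_layer s (Suc j))"
    by (intro card_inj_on_le[where f = ?f] finite_bt_layer) (auto simp: inj_on_def)
  then show ?case using Suc by (simp add: card_cartesian_product)
qed

text \<open>Stripping the prefix \<open>w\<close> leaves a suffix whose constraints involve only
  \<open>j\<close>. The right-hand side is free of \<open>w\<close>: all subtrees hanging from layer
  \<open>j\<close> have equally many vertices deeper than \<open>g\<close>.\<close>

lemma card_bt_descendants:
  assumes "j \<le> g" "w \<in> bt_layer s j"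
  shows "card {v \<in> bt_verts s h. g < length v \<and> take j v = w} =
    card {ys. g - j < length ys \<and> j + length ys \<le> h \<and> (\<forall>i<length ys. ys ! i < s (Suc (j + i)))}"
    (is "card ?A = card ?B")
proof -
  have lw: "length w = j" using assms(2) by (simp add: bt_layer_def)
  have "bij_betw ((@) w) ?B ?A"
  proof (rule bij_betw_byWitness[where f' = "drop j"])
    show "\<forall>a\<in>?B. drop j (w @ a) = a" using lw by simp
    show "\<forall>a'\<in>?A. w @ drop j a' = a'" by auto
    show "(@) w ` ?B \<subseteq> ?A"
    proof (clarsimp simp: lw)
      fix ys assume ys: "g - j < length ys" "j + length ys \<le> h" "\<forall>i<length ys. ys ! i < s (Suc (j + i))"
      have "(w @ ys) ! i < s (Suc i)" if "i < j + length ys" for i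
        using that assms(2) ys(3)[rule_format, of "i - j"]
        by (cases "i < j") (auto simp: nth_append bt_layer_def)
      then show "w @ ys \<in> bt_verts s h \<and> g < j + length ys"
        using ys assms(1) by (auto simp: bt_verts_def lw)
    qed
    show "drop j ` ?A \<subseteq> ?B"
      using assms(1) by (auto simp: bt_verts_def)
  qed
  then show ?thesis by (simp add: bij_betw_same_card)
qed

lemma take_in_bt_layer: "v \<in> bt_verts s h \<Longrightarrow> j \<le> length v \<Longrightarrow> take j v \<in> bt_layer s j"
  by (auto simp: bt_verts_def bt_layer_def)

subsection \<open>Grid cells of the cube\<close>

lemma dist_cart_le:
  fixes x y :: "real^'d"
  assumes "\<And>i. \<bar>x $ i - y $ i\<bar> \<le> b"
  shows "dist x y \<le> sqrt (real CARD('d)) * b"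
proof -
  have "0 \<le> b" using assms[of undefined] by linarith
  have "dist x y \<le> L2_set (\<lambda>_. b) (UNIV :: 'd set)"
    unfolding dist_vec_def by (intro L2_set_mono) (use assms in \<open>auto simp: dist_real_def\<close>)
  also have "\<dots> = sqrt (real CARD('d)) * b"
    using \<open>0 \<le> b\<close> by (simp add: L2_set_def real_sqrt_mult)
  finally show ?thesis .
qed

lemma dist_cart_ge:
  fixes x y :: "real^'d"
  assumes "\<And>i. b \<le> \<bar>x $ i - y $ i\<bar>" "0 \<le> b"
  shows "sqrt (real CARD('d)) * b \<le> dist x y"
proof -
  have "sqrt (real CARD('d)) * b = L2_set (\<lambda>_. b) (UNIV :: 'd set)"
    using \<open>0 \<le> b\<close> by (simp add: L2_set_def real_sqrt_mult)
  also have "\<dots> \<le> dist x y"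
    unfolding dist_vec_def by (intro L2_set_mono) (use assms in \<open>auto simp: dist_real_def\<close>)
  finally show ?thesis .
qed

text \<open>The minimum puts the face where a coordinate equals 1 into the last cell instead of
  creating an extra one.\<close>

definition cell_index :: "nat \<Rightarrow> real^'d \<Rightarrow> 'd \<Rightarrow> nat" where
  "cell_index k x = (\<lambda>i. min (k - 1) (nat \<lfloor>real k * x $ i\<rfloor>))"

lemma cell_index_less: "k > 0 \<Longrightarrow> cell_index k x i < k"
  by (auto simp: cell_index_def)

lemma cell_index_bounds:
  assumes "x \<in> unit_cube" "k > 0"
  shows "real (cell_index k x i) \<le> real k * x $ i" "real k * x $ i \<le> real (cell_index k x i) + 1"
proof -
  have x: "0 \<le> x $ i" "x $ i \<le> 1" using assms by (auto simp: unit_cube_def)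
  then have kx: "0 \<le> real k * x $ i" "real k * x $ i \<le> real k" using assms
    by (auto intro: mult_left_le)
  have fl: "real (nat \<lfloor>real k * x $ i\<rfloor>) = of_int \<lfloor>real k * x $ i\<rfloor>" using kx by simp
  show "real (cell_index k x i) \<le> real k * x $ i"
  proof -
    have "real (cell_index k x i) \<le> real (nat \<lfloor>real k * x $ i\<rfloor>)" by (simp add: cell_index_def)
    then show ?thesis using fl of_int_floor_le[of "real k * x $ i"] by linarith
  qed
  show "real k * x $ i \<le> real (cell_index k x i) + 1"
    using fl kx assms(2) by (auto simp: cell_index_def min_def of_nat_diff)
qed

lemma unit_cube_eq_cbox: "(unit_cube :: (real^'d) set) = cbox 0 1"
  by (auto simp: unit_cube_def mem_box_cart)

lemma unit_cube_borel [measurable]: "(unit_cube :: (real^'d) set) \<in> sets borel"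
  by (simp add: unit_cube_eq_cbox)

lemma measurable_cell_index [measurable]: "(\<lambda>x :: real^'d. cell_index k x i) \<in> borel \<rightarrow>\<^sub>M count_space UNIV"
  unfolding cell_index_def by measurable

lemma measurable_cell_index_pred [measurable]:
  "Measurable.pred borel (\<lambda>x :: real^'d. cell_index k x = v)"
  unfolding fun_eq_iff by measurable

lemma emeasure_unit_cube: "emeasure lborel (unit_cube :: (real^'d) set) = 1"
proof -
  have "measure lborel (unit_cube :: (real^'d) set) = 1"
    unfolding unit_cube_eq_cbox by (subst content_cbox_cart) (auto simp: interval_ne_empty_cart)
  then show ?thesis
    by (metis emeasure_eq_ennreal_measure ennreal_1 measure_zero_top zero_neq_one)
qed

text \<open>The cell lies between an open box and the closed box with the same corners, whose
  volumes agree, so the treatment of cell boundaries does not matter.\<close>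

lemma measure_cell:
  fixes v :: "'d::finite \<Rightarrow> nat"
  assumes k: "k > 0" and v: "\<And>i. v i < k"
  shows "measure lborel {x \<in> unit_cube :: (real^'d) set. cell_index k x = v} = 1 / real (k ^ CARD('d))"
proof -
  define a b :: "real^'d" where "a = (\<chi> i. real (v i) / real k)" and "b = (\<chi> i. (real (v i) + 1) / real k)"
  let ?C = "{x \<in> unit_cube :: (real^'d) set. cell_index k x = v}"
  have [measurable]: "?C \<in> sets borel" by measurable
  have ab: "a $ i \<le> b $ i" for i by (simp add: a_def b_def divide_right_mono)
  then have "cbox a b \<noteq> {}" by (auto simp: interval_ne_empty_cart)
  then have "measure lborel (cbox a b) = (\<Prod>i\<in>(UNIV :: 'd set). b $ i - a $ i)"
    by (subst content_cbox_cart) auto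
  also have "\<dots> = (\<Prod>i\<in>(UNIV :: 'd set). 1 / real k)"
    by (intro prod.cong) (auto simp: a_def b_def diff_divide_distrib[symmetric])
  also have "\<dots> = 1 / real (k ^ CARD('d))" by (simp add: power_one_over)
  finally have cb: "measure lborel (cbox a b) = 1 / real (k ^ CARD('d))" .
  have bx: "measure lborel (box a b) = measure lborel (cbox a b)"
    by (simp add: measure_def emeasure_lborel_box_eq emeasure_lborel_cbox_eq)
  have sub1: "box a b \<subseteq> ?C"
  proof
    fix x assume "x \<in> box a b"
    then have "real (v i) / real k < x $ i \<and> x $ i < (real (v i) + 1) / real k" for i
      by (auto simp: mem_box_cart a_def b_def)
    then have x: "real (v i) < real k * x $ i \<and> real k * x $ i < real (v i) + 1" for i
      using k by (simp add: field_simps)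
    have fl: "\<lfloor>real k * x $ i\<rfloor> = int (v i)" for i using x[of i] by linarith
    have "cell_index k x i = v i" for i using v[of i] fl[of i] by (auto simp: cell_index_def)
    moreover have "0 \<le> x $ i \<and> x $ i \<le> 1" for i
    proof -
      have "real (v i) + 1 \<le> real k" using v[of i] by linarith
      then have "0 < real k * x $ i" "real k * x $ i < real k * 1"
        using x[of i] v[of i] by linarith+
      then show ?thesis using k by (simp add: zero_less_mult_iff)
    qed
    ultimately show "x \<in> ?C" by (auto simp: unit_cube_def)
  qed
  have sub2: "?C \<subseteq> cbox a b"
  proof clarify
    fix x :: "real^'d" assume x: "x \<in> unit_cube" "v = cell_index k x"
    show "x \<in> cbox a b" unfolding mem_box_cart
      using cell_index_bounds[OF x(1) k] k x(2) by (auto simp: a_def b_def field_simps)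
  qed
  have "emeasure lborel (box a b) \<le> emeasure lborel ?C" "emeasure lborel ?C \<le> emeasure lborel (cbox a b)"
    using sub1 sub2 by (auto intro!: emeasure_mono)
  then have "emeasure lborel ?C = emeasure lborel (cbox a b)"
    by (simp add: emeasure_lborel_box_eq emeasure_lborel_cbox_eq)
  then show ?thesis using cb by (simp add: measure_def)
qed

text \<open>\<open>\<sigma> x\<close> is the position of the cell of \<open>x\<close> in an order of the cells in which consecutive cells touch.\<close>

locale cell_order =
  fixes k cells :: nat and \<sigma> :: "real^'d \<Rightarrow> nat"
  assumes k_pos: "k > 0"
    and cells_eq: "cells = k ^ CARD('d)"
    and less: "\<sigma> x < cells"
    and measurable_\<sigma> [measurable]: "\<sigma> \<in> borel \<rightarrow>\<^sub>M count_space UNIV"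
    and measure_fibre: "i < cells \<Longrightarrow> measure lborel {x \<in> unit_cube. \<sigma> x = i} = 1 / real cells"
    and dist_same: "x \<in> unit_cube \<Longrightarrow> y \<in> unit_cube \<Longrightarrow> \<sigma> x = \<sigma> y \<Longrightarrow>
      dist x y \<le> sqrt (real CARD('d)) / real k"
    and dist_next: "x \<in> unit_cube \<Longrightarrow> y \<in> unit_cube \<Longrightarrow> \<sigma> x \<le> Suc (\<sigma> y) \<Longrightarrow> \<sigma> y \<le> Suc (\<sigma> x) \<Longrightarrow>
      dist x y \<le> 2 * sqrt (real CARD('d)) / real k"
    and far_cell: "x \<in> unit_cube \<Longrightarrow> \<exists>i<cells. \<forall>y\<in>unit_cube. \<sigma> y = i \<longrightarrow>
      sqrt (real CARD('d)) * (1 / 2 - 1 / real k) \<le> dist x y"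

text \<open>The label of a point is the position of its cell in the snake order. The bound
  \<open>k > 1\<close> keeps \<open>1 / 2 - 1 / k\<close> nonnegative.\<close>

lemma cell_order_exists:
  assumes k: "k > 1"
  shows "\<exists>\<sigma> :: real^'d \<Rightarrow> nat. cell_order k (k ^ CARD('d)) \<sigma>"
proof -
  let ?V = "{f :: 'd \<Rightarrow> nat. \<forall>i. f i < k}"
  let ?R = "\<lambda>(f::'d \<Rightarrow> nat) g. \<forall>i. f i \<le> Suc (g i) \<and> g i \<le> Suc (f i)"
  have "\<exists>xs. distinct xs \<and> set xs = {f :: 'd \<Rightarrow> nat. (\<forall>i\<in>UNIV. f i < k) \<and> (\<forall>i. i \<notin> UNIV \<longrightarrow> f i = 0)}
    \<and> successively ?R xs"
    using k by (intro snake_order) auto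
  then obtain xs where xs: "distinct xs" "set xs = ?V" "successively ?R xs" by auto
  have cardV: "card ?V = k ^ CARD('d)"
  proof -
    have "?V = (UNIV :: 'd set) \<rightarrow>\<^sub>E {..<k}" by (auto simp: PiE_def Pi_def)
    then show ?thesis by (simp add: card_PiE)
  qed
  then have len: "length xs = k ^ CARD('d)" using xs by (metis distinct_card)
  define pos where "pos v = (THE i. i < length xs \<and> xs ! i = v)" for v
  have pos: "pos v < length xs" "xs ! pos v = v" if "v \<in> ?V" for v
  proof -
    have "\<exists>!i. i < length xs \<and> xs ! i = v" using distinct_Ex1[OF xs(1)] that xs(2) by blast
    then have "pos v < length xs \<and> xs ! pos v = v" unfolding pos_def by (rule theI')
    then show "pos v < length xs" "xs ! pos v = v" by auto
  qed
  define \<sigma> where "\<sigma> x = pos (cell_index k x)" for x :: "real^'d"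
  have ciV: "cell_index k x \<in> ?V" for x :: "real^'d" using k by (simp add: cell_index_less)
  have \<sigma>: "\<sigma> x < length xs" "xs ! \<sigma> x = cell_index k x" for x unfolding \<sigma>_def using pos ciV by blast+
  have \<sigma>_eq: "\<sigma> x = i \<longleftrightarrow> cell_index k x = xs ! i" if "i < length xs" for x i
    using \<sigma>[of x] that xs(1) by (auto simp: nth_eq_iff_index_eq)
  \<comment> \<open>The cell index takes finitely many values, so measurability can be checked on
    single values.\<close>
  have meas: "\<sigma> \<in> borel \<rightarrow>\<^sub>M count_space UNIV"
  proof -
    have "cell_index k \<in> borel \<rightarrow>\<^sub>M count_space ?V"
    proof (subst measurable_count_space_eq2)
      show "finite ?V" using cardV k by (intro card_ge_0_finite) auto
      have "cell_index k -` {a} \<inter> space borel \<in> sets borel" for a :: "'d \<Rightarrow> nat"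
        using measurable_cell_index_pred[of k a] by (simp add: pred_def vimage_def)
      then show "cell_index k \<in> space borel \<rightarrow> ?V \<and> (\<forall>a\<in>?V. cell_index k -` {a} \<inter> space borel \<in> sets borel)"
        using ciV by blast
    qed
    then have "(\<lambda>x. pos (cell_index k x)) \<in> borel \<rightarrow>\<^sub>M count_space UNIV"
      by (rule measurable_compose) simp
    then show ?thesis by (simp add: \<sigma>_def[abs_def])
  qed
  show ?thesis
  proof (intro exI[of _ \<sigma>] cell_order.intro)
    show "0 < k" using k by simp
    show "k ^ CARD('d) = k ^ CARD('d)" ..
    show "\<sigma> x < k ^ CARD('d)" for x using \<sigma>(1) len by simp
    show "\<sigma> \<in> borel \<rightarrow>\<^sub>M count_space UNIV" by (fact meas)
    show "measure lborel {x \<in> unit_cube. \<sigma> x = i} = 1 / real (k ^ CARD('d))" if i: "i < k ^ CARD('d)" for i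
    proof -
      have "xs ! i \<in> ?V" using i len xs(2) nth_mem by metis
      then show ?thesis using \<sigma>_eq i len measure_cell[of k "xs ! i"] k by simp
    qed
    \<comment> \<open>Used with \<open>m = 0\<close> for a common cell and with \<open>m = 1\<close>
      for touching cells.\<close>
    have cl: "\<bar>x $ i - y $ i\<bar> \<le> (1 + real m) / real k"
      if "x \<in> unit_cube" "y \<in> unit_cube" "cell_index k x i \<le> m + cell_index k y i" "cell_index k y i \<le> m + cell_index k x i"
      for x y :: "real^'d" and i m
    proof -
      have "\<bar>real k * x $ i - real k * y $ i\<bar> \<le> 1 + real m"
        using cell_index_bounds[OF that(1), of k i] cell_index_bounds[OF that(2), of k i] that(3,4) k by linarith
      then have "real k * \<bar>x $ i - y $ i\<bar> \<le> 1 + real m"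
        by (metis abs_mult abs_of_nat right_diff_distrib)
      then show ?thesis using k by (simp add: field_simps)
    qed
    show "dist x y \<le> sqrt (real CARD('d)) / real k"
      if "x \<in> unit_cube" "y \<in> unit_cube" "\<sigma> x = \<sigma> y" for x y
    proof -
      have "cell_index k x = cell_index k y" using \<sigma>(2) that(3) by metis
      then show ?thesis using dist_cart_le[of x y "1 / real k"] cl[OF that(1,2), of _ 0] by simp
    qed
    show "dist x y \<le> 2 * sqrt (real CARD('d)) / real k"
      if xy: "x \<in> unit_cube" "y \<in> unit_cube" "\<sigma> x \<le> Suc (\<sigma> y)" "\<sigma> y \<le> Suc (\<sigma> x)" for x y
    proof -
      have s: "?R (xs ! i) (xs ! Suc i)" if "Suc i < length xs" for i
        using xs(3) that by (auto simp: successively_conv_nth)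
      consider "\<sigma> x = \<sigma> y" | "\<sigma> x = Suc (\<sigma> y)" | "\<sigma> y = Suc (\<sigma> x)" using xy(3,4) by linarith
      then have "?R (cell_index k x) (cell_index k y)"
      proof cases
        case 1
        then have "cell_index k x = cell_index k y" using \<sigma>(2) by metis
        then show ?thesis by simp
      next
        case 2
        then show ?thesis using s[of "\<sigma> y"] \<sigma>[of x] \<sigma>[of y] by auto
      next
        case 3
        then show ?thesis using s[of "\<sigma> x"] \<sigma>[of x] \<sigma>[of y] by auto
      qed
      then show ?thesis using dist_cart_le[of x y "2 / real k"] cl[OF xy(1,2), of _ 1] by (simp add: mult.commute)
    qed
    show "\<exists>i<k ^ CARD('d). \<forall>y\<in>unit_cube. \<sigma> y = i \<longrightarrow>
      sqrt (real CARD('d)) * (1 / 2 - 1 / real k) \<le> dist x y" if x: "x \<in> unit_cube" for x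
    proof -
      \<comment> \<open>The corner cell opposite to \<open>x\<close>: in each coordinate the extreme
        cell on the side away from the point.\<close>
      define v where "v i = (if x $ i \<ge> 1 / 2 then 0 else k - 1)" for i
      have v: "v \<in> ?V" using k by (auto simp: v_def)
      have "sqrt (real CARD('d)) * (1 / 2 - 1 / real k) \<le> dist x y" if y: "y \<in> unit_cube" "\<sigma> y = pos v" for y
      proof (rule dist_cart_ge)
        have ci: "cell_index k y = v" using \<sigma>(2)[of y] pos[OF v] y(2) by simp
        fix i
        have b: "real (v i) \<le> real k * y $ i" "real k * y $ i \<le> real (v i) + 1"
          using cell_index_bounds[OF y(1), of k i] ci k by auto
        have "real (v i) / real k \<le> y $ i" "y $ i \<le> (real (v i) + 1) / real k"
          using b k by (simp_all add: field_simps)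
        moreover have "real (k - 1) / real k = 1 - 1 / real k" using k by (simp add: field_simps of_nat_diff)
        ultimately show "1 / 2 - 1 / real k \<le> \<bar>x $ i - y $ i\<bar>"
          unfolding v_def by (cases "x $ i \<ge> 1 / 2") auto
      next
        show "0 \<le> 1 / 2 - 1 / real k" using k by (simp add: field_simps)
      qed
      then show ?thesis using pos(1)[OF v] len by auto
    qed
  qed
qed

subsection \<open>Concentration of the point counts\<close>

abbreviation uniform_cube :: "(real^'d) measure" where
  "uniform_cube \<equiv> uniform_measure lborel unit_cube"

lemma prob_space_uniform_cube: "prob_space (uniform_cube :: (real^'d) measure)"
  by (intro prob_space_uniform_measure) (simp_all add: emeasure_unit_cube)

interpretation rgg: product_prob_space "\<lambda>_. uniform_cube :: (real^'d) measure" "UNIV :: nat set"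
  rewrites "Pi\<^sub>M UNIV (\<lambda>_ :: nat. uniform_cube :: (real^'d) measure) = rgg_space"
proof -
  interpret prob_space "uniform_cube :: (real^'d) measure" by (rule prob_space_uniform_cube)
  show "product_prob_space (\<lambda>_ :: nat. uniform_cube :: (real^'d) measure)"
    by unfold_locales
qed (simp add: rgg_space_def)

lemma sets_rgg_space [measurable_cong]: "sets (rgg_space :: (nat \<Rightarrow> real^'d) measure) = sets (\<Pi>\<^sub>M i\<in>UNIV. borel)"
  unfolding rgg_space_def by (intro sets_PiM_cong) auto

lemma space_rgg_space [simp]: "space (rgg_space :: (nat \<Rightarrow> real^'d) measure) = UNIV"
  by (simp add: rgg_space_def space_PiM)

lemma measurable_rgg_coordinate [measurable]: "(\<lambda>\<omega>. \<omega> i) \<in> (rgg_space :: (nat \<Rightarrow> real^'d) measure) \<rightarrow>\<^sub>M borel"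
  by measurable

lemma measurable_rgg_eq [measurable]:
  "Measurable.pred (rgg_space :: (nat \<Rightarrow> real^'d) measure) (\<lambda>\<omega>. \<omega> i = \<omega> j)"
proof -
  have "Measurable.pred (rgg_space :: (nat \<Rightarrow> real^'d) measure) (\<lambda>\<omega>. dist (\<omega> i) (\<omega> j) = 0)"
    by measurable
  then show ?thesis by simp
qed

text \<open>Independence means that the joint law is the product of the marginals, and here the
  joint map is the identity of a product space.\<close>

lemma indep_vars_rgg_coordinates:
  "rgg.indep_vars (\<lambda>_. uniform_cube) (\<lambda>i \<omega>. \<omega> i) (UNIV :: nat set)"
proof (subst rgg.indep_vars_iff_distr_eq_PiM)
  show "UNIV \<noteq> ({} :: nat set)" by simp
  show "rgg.random_variable uniform_cube (\<lambda>\<omega>. \<omega> i)" for i by measurable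
  have "distr rgg_space (\<Pi>\<^sub>M i\<in>UNIV. uniform_cube) (\<lambda>x. \<lambda>i\<in>UNIV. x i) = distr rgg_space rgg_space (\<lambda>x. x)"
    by (intro distr_cong) (auto simp: rgg_space_def)
  also have "\<dots> = rgg_space" by simp
  also have "\<dots> = (\<Pi>\<^sub>M i\<in>UNIV. distr rgg_space uniform_cube (\<lambda>\<omega>. \<omega> i))"
  proof -
    have *: "distr rgg_space uniform_cube (\<lambda>\<omega>. \<omega> i) = uniform_cube" for i :: nat
      using rgg.PiM_component[of i] by simp
    show ?thesis unfolding * by (rule rgg_space_def)
  qed
  finally show "distr rgg_space (\<Pi>\<^sub>M i\<in>UNIV. uniform_cube) (\<lambda>x. \<lambda>i\<in>UNIV. x i) =
    (\<Pi>\<^sub>M i\<in>UNIV. distr rgg_space uniform_cube (\<lambda>\<omega>. \<omega> i))" .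
qed

lemma AE_rgg_unit_cube: "AE \<omega> in (rgg_space :: (nat \<Rightarrow> real^'d) measure). \<forall>i. \<omega> i \<in> unit_cube"
  unfolding AE_all_countable
proof
  fix i
  have "AE x in (uniform_cube :: (real^'d) measure). x \<in> unit_cube"
    by (rule AE_uniform_measureI) auto
  then show "AE \<omega> in (rgg_space :: (nat \<Rightarrow> real^'d) measure). \<omega> i \<in> unit_cube"
    by (intro rgg.AE_component) auto
qed

section \<open>Hoeffding bounds for initial segments of the cell order\<close>

context cell_order
begin

lemma cells_pos: "cells > 0"
  using k_pos by (simp add: cells_eq)

lemma measure_uniform_fibre: "c < cells \<Longrightarrow> measure uniform_cube {x. \<sigma> x = c} = 1 / real cells"
  using measure_fibre[of c] by (subst measure_uniform_measure) (auto simp: emeasure_unit_cube measure_def Int_def)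

lemma measure_uniform_prefix:
  assumes "c < cells"
  shows "measure uniform_cube {x. \<sigma> x \<le> c} = (real c + 1) / real cells"
proof -
  have "{x. \<sigma> x \<le> c} = (\<Union>i\<in>{..c}. {x. \<sigma> x = i})" by auto
  also have "measure uniform_cube \<dots> = (\<Sum>i\<in>{..c}. measure uniform_cube {x. \<sigma> x = i})"
    by (intro rgg.M.finite_measure_finite_Union) (auto simp: disjoint_family_on_def)
  also have "\<dots> = (\<Sum>i\<in>{..c}. 1 / real cells)"
    using assms by (intro sum.cong refl measure_uniform_fibre) auto
  also have "\<dots> = (real c + 1) / real cells" by simp
  finally show ?thesis .
qed

definition prefix_count :: "(nat \<Rightarrow> real^'d) \<Rightarrow> nat \<Rightarrow> nat \<Rightarrow> nat" where
  "prefix_count \<omega> n c = card {p. p < n \<and> \<sigma> (\<omega> p) \<le> c}"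

text \<open>The tolerance is an eighth of \<open>n / cells\<close>, the mean count of one cell. A
  cell is the difference of two initial segments, so without deviations its count is within a
  quarter of the mean.\<close>

definition deviates :: "(nat \<Rightarrow> real^'d) \<Rightarrow> nat \<Rightarrow> nat \<Rightarrow> bool" where
  "deviates \<omega> n c \<longleftrightarrow>
    real n / (8 * real cells) \<le> \<bar>real (prefix_count \<omega> n c) - real n * (real c + 1) / real cells\<bar>"

lemma prefix_count_eq_sum:
  "real (prefix_count \<omega> n c) = (\<Sum>p<n. indicator {x. \<sigma> x \<le> c} (\<omega> p))"
proof -
  have "(\<Sum>p<n. indicator {x. \<sigma> x \<le> c} (\<omega> p) :: real) = (\<Sum>p\<in>{..<n}. if \<sigma> (\<omega> p) \<le> c then 1 else 0)"
    by (intro sum.cong) (auto simp: indicator_def)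
  also have "\<dots> = real (card ({..<n} \<inter> {p. \<sigma> (\<omega> p) \<le> c}))"
    by (simp add: sum.If_cases)
  finally show ?thesis unfolding prefix_count_def by (simp add: Int_def)
qed

lemma measurable_deviates [measurable]: "Measurable.pred rgg_space (\<lambda>\<omega>. deviates \<omega> n c)"
  unfolding deviates_def prefix_count_eq_sum by measurable

text \<open>Hoeffding's inequality for \<open>n\<close> variables in [0,1] and deviation
  \<open>t = n / (8 * cells)\<close>, with exponent \<open>- 2 * t^2 / n\<close>.\<close>

lemma prob_deviates_le:
  assumes n: "n > 0" and c: "c < cells"
  shows "rgg.prob {\<omega>. deviates \<omega> n c} \<le> 2 * exp (- real n / (32 * (real cells)\<^sup>2))"
proof -
  let ?X = "\<lambda>p \<omega>. indicator {x. \<sigma> x \<le> c} (\<omega> p) :: real"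
  have [measurable]: "{x. \<sigma> x \<le> c} \<in> sets borel" by measurable
  have "rgg.indep_vars (\<lambda>_. borel) ?X (UNIV :: nat set)"
    by (rule rgg.indep_vars_compose2[OF indep_vars_rgg_coordinates]) (intro borel_measurable_indicator, simp)
  then have "rgg.indep_vars (\<lambda>_. borel) ?X {..<n}"
    by (rule rgg.indep_vars_subset) auto
  then interpret H: Hoeffding_ineq rgg_space "{..<n}" ?X "\<lambda>_. 0" "\<lambda>_. 1" "\<Sum>p<n. rgg.expectation (?X p)"
    by unfold_locales (auto simp: indicator_def)
  have "rgg.expectation (?X p) = (real c + 1) / real cells" for p
  proof -
    have "rgg.expectation (?X p) = rgg.expectation (indicator {\<omega>. \<sigma> (\<omega> p) \<le> c})"
      by (intro Bochner_Integration.integral_cong) (auto simp: indicator_def)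
    also have "\<dots> = rgg.prob {\<omega>. \<sigma> (\<omega> p) \<le> c}" by simp
    also have "\<dots> = measure uniform_cube {x. \<sigma> x \<le> c}"
      using rgg.emeasure_PiM_Collect_single[of p "{x. \<sigma> x \<le> c}"] by (simp add: measure_def)
    also have "\<dots> = (real c + 1) / real cells" by (rule measure_uniform_prefix[OF c])
    finally show ?thesis .
  qed
  then have mu: "(\<Sum>p<n. rgg.expectation (?X p)) = real n * (real c + 1) / real cells" by simp
  have "rgg.prob {\<omega>. deviates \<omega> n c} =
    rgg.prob {\<omega> \<in> space rgg_space. real n / (8 * real cells) \<le> \<bar>(\<Sum>p<n. ?X p \<omega>) - real n * (real c + 1) / real cells\<bar>}"
    unfolding deviates_def prefix_count_eq_sum by simp
  also have "\<dots> \<le> 2 * exp (- 2 * (real n / (8 * real cells))\<^sup>2 / (\<Sum>p<n. (1 - 0)\<^sup>2))"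
    unfolding mu[symmetric] using n by (intro H.Hoeffding_ineq_abs_ge) auto
  also have "- 2 * (real n / (8 * real cells))\<^sup>2 / (\<Sum>p<n. (1 - 0)\<^sup>2) = - real n / (32 * (real cells)\<^sup>2)"
    using n cells_pos by (simp add: field_simps power2_eq_square)
  finally show ?thesis .
qed

text \<open>All sizes from \<open>N\<close> on are covered, so that with \<open>N = 2 ^ h\<close>
  one event serves all trees of height \<open>h\<close> at once.\<close>

definition deviation_event :: "nat \<Rightarrow> (nat \<Rightarrow> real^'d) set" where
  "deviation_event N = {\<omega>. \<exists>n\<ge>N. \<exists>c<cells. deviates \<omega> n c}"

lemma deviation_event_sets [measurable]: "deviation_event N \<in> sets rgg_space"
proof -
  have "{\<omega> \<in> space rgg_space. \<exists>n\<ge>N. \<exists>c<cells. deviates \<omega> n c} \<in> sets rgg_space"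
    by measurable
  then show ?thesis by (simp add: deviation_event_def)
qed

text \<open>The union bound over cells and sizes gives a geometric series of ratio
  \<open>exp (- a)\<close>. Its sum contributes at most \<open>2 / a = 64 * cells^2\<close>, which
  together with the factor \<open>2 * cells\<close> makes the constant 128 and the cube.\<close>

lemma prob_deviation_event_le:
  assumes N: "N > 0"
  shows "rgg.prob (deviation_event N) \<le> 128 * (real cells) ^ 3 * exp (- real N / (32 * (real cells)\<^sup>2))"
proof -
  define a where "a = 1 / (32 * (real cells)\<^sup>2)"
  have c1: "real cells \<ge> 1" using cells_pos by linarith
  have "1 \<le> (real cells)\<^sup>2" using c1 by (rule one_le_power)
  then have "1 \<le> 32 * (real cells)\<^sup>2" by linarith
  then have a: "0 < a" "a \<le> 1" using cells_pos by (simp_all add: a_def)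
  define A where "A n = (\<Union>c\<in>{..<cells}. {\<omega>. deviates \<omega> (N + n) c})" for n
  have A_sets: "{\<omega>. deviates \<omega> n c} \<in> sets rgg_space" for n c
    using measurable_deviates[of n c] by (simp add: pred_def)
  have A_le: "rgg.prob (A n) \<le> 2 * real cells * exp (- a * real N) * exp (- a) ^ n" for n
  proof -
    have "rgg.prob (A n) \<le> (\<Sum>c<cells. rgg.prob {\<omega>. deviates \<omega> (N + n) c})"
      unfolding A_def using A_sets by (intro rgg.finite_measure_subadditive_finite) auto
    also have "\<dots> \<le> (\<Sum>c<cells. 2 * exp (- real (N + n) / (32 * (real cells)\<^sup>2)))"
      using N by (intro sum_mono prob_deviates_le) auto
    also have "\<dots> = 2 * real cells * exp (- a * real N) * exp (- a) ^ n"
      by (simp add: a_def exp_add[symmetric] exp_of_nat_mult[symmetric] add_divide_distrib diff_divide_distrib)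
    finally show ?thesis .
  qed
  have geo: "(\<lambda>n. 2 * real cells * exp (- a * real N) * exp (- a) ^ n) sums
      (2 * real cells * exp (- a * real N) * (1 / (1 - exp (- a))))"
    using a by (intro sums_mult geometric_sums) auto
  have summ: "summable (\<lambda>n. rgg.prob (A n))"
    by (rule summable_comparison_test'[OF sums_summable[OF geo], of 0]) (use A_le in auto)
  have "deviation_event N = (\<Union>n. A n)"
    unfolding deviation_event_def A_def by (auto simp: le_iff_add)
  also have "rgg.prob (\<Union>n. A n) \<le> (\<Sum>n. rgg.prob (A n))"
    using A_sets summ by (intro rgg.finite_measure_subadditive_countably) (auto simp: A_def)
  also have "\<dots> \<le> (\<Sum>n. 2 * real cells * exp (- a * real N) * exp (- a) ^ n)"
    using A_le summ sums_summable[OF geo] by (intro suminf_le) auto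
  also have "\<dots> = 2 * real cells * exp (- a * real N) * (1 / (1 - exp (- a)))"
    using geo by (simp add: sums_iff)
  also have "\<dots> \<le> 2 * real cells * exp (- a * real N) * (2 / a)"
  proof (intro mult_left_mono)
    have "exp (- a) * (1 + a) \<le> exp (- a) * exp a" by (intro mult_left_mono exp_ge_add_one_self) auto
    then have "exp (- a) * (1 + a) \<le> 1" by (simp add: exp_minus)
    then have "exp (- a) \<le> 1 / (1 + a)" using a by (simp add: field_simps)
    also have "\<dots> \<le> 1 - a / 2" using a by (simp add: field_simps)
    finally have "a / 2 \<le> 1 - exp (- a)" by simp
    then show "1 / (1 - exp (- a)) \<le> 2 / a" using a by (simp add: field_simps)
  qed auto
  also have "\<dots> = 128 * (real cells) ^ 3 * exp (- real N / (32 * (real cells)\<^sup>2))"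
    by (simp add: a_def power2_eq_square power3_eq_cube)
  finally show ?thesis .
qed

text \<open>Coinciding points share a cell, which for two independent points has probability
  \<open>1 / cells\<close>.\<close>

lemma prob_same_point_le:
  assumes "i \<noteq> j"
  shows "rgg.prob {\<omega> :: nat \<Rightarrow> real^'d. \<omega> i = \<omega> j} \<le> 1 / real k"
proof -
  have [measurable]: "{x. \<sigma> x = c} \<in> sets borel" for c by measurable
  have s: "{\<omega> \<in> space rgg_space. \<forall>p\<in>{i, j}. \<omega> p \<in> {x. \<sigma> x = c}} \<in> sets rgg_space" for c
    by measurable
  have "rgg.prob {\<omega> :: nat \<Rightarrow> real^'d. \<omega> i = \<omega> j} \<le>
    rgg.prob (\<Union>c\<in>{..<cells}. {\<omega> \<in> space rgg_space. \<forall>p\<in>{i, j}. \<omega> p \<in> {x. \<sigma> x = c}})"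
    using s less by (intro rgg.finite_measure_mono sets.finite_UN) auto
  also have "\<dots> \<le> (\<Sum>c<cells. rgg.prob {\<omega> \<in> space rgg_space. \<forall>p\<in>{i, j}. \<omega> p \<in> {x. \<sigma> x = c}})"
    using s by (intro rgg.finite_measure_subadditive_finite) auto
  also have "\<dots> = (\<Sum>c<cells. (1 / real cells)\<^sup>2)"
  proof (intro sum.cong refl)
    fix c assume c: "c \<in> {..<cells}"
    have "emeasure rgg_space {\<omega> \<in> space rgg_space. \<forall>p\<in>{i, j}. \<omega> p \<in> {x. \<sigma> x = c}} =
      (\<Prod>p\<in>{i, j}. emeasure uniform_cube {x. \<sigma> x = c})"
      by (rule rgg.emeasure_PiM_Collect) auto
    also have "\<dots> = ennreal (measure uniform_cube {x. \<sigma> x = c} ^ 2)"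
      using assms by (simp add: rgg.M.emeasure_eq_measure ennreal_mult[symmetric] power2_eq_square)
    finally show "rgg.prob {\<omega> \<in> space rgg_space. \<forall>p\<in>{i, j}. \<omega> p \<in> {x. \<sigma> x = c}} = (1 / real cells)\<^sup>2"
      using measure_uniform_fibre c by (simp add: measure_def)
  qed
  also have "\<dots> = 1 / real cells" using cells_pos by (simp add: power2_eq_square)
  also have "\<dots> \<le> 1 / real k"
  proof -
    have "k ^ 1 \<le> cells" unfolding cells_eq using k_pos by (intro power_increasing) (auto simp: Suc_leI)
    then show ?thesis using k_pos by (intro divide_left_mono) (auto simp flip: of_nat_power)
  qed
  finally show ?thesis .
qed

end

text \<open>Two given points coincide with probability at most \<open>1 / k\<close> for every
  \<open>k > 1\<close>, hence with probability zero; there are countably many pairs.\<close>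

lemma AE_rgg_inj: "AE \<omega> in (rgg_space :: (nat \<Rightarrow> real^'d) measure). inj \<omega>"
proof -
  have "AE \<omega> in (rgg_space :: (nat \<Rightarrow> real^'d) measure). i \<noteq> j \<longrightarrow> \<omega> i \<noteq> \<omega> j" for i j
  proof (cases "i = j")
    case False
    let ?S = "{\<omega> :: nat \<Rightarrow> real^'d. \<omega> i = \<omega> j}"
    have "{\<omega> \<in> space rgg_space. (\<omega> :: nat \<Rightarrow> real^'d) i = \<omega> j} \<in> sets rgg_space" by measurable
    then have S: "?S \<in> sets rgg_space" by simp
    have "rgg.prob ?S \<le> 1 / real k" if k: "k > 1" for k
    proof -
      obtain \<sigma> :: "real^'d \<Rightarrow> nat" where "cell_order k (k ^ CARD('d)) \<sigma>" using cell_order_exists[OF k] by blast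
      then show ?thesis using cell_order.prob_same_point_le False by blast
    qed
    then have "\<forall>\<^sub>F k in sequentially. rgg.prob ?S \<le> 1 / real k"
      by (intro eventually_mono[OF eventually_gt_at_top[of 1]])
    then have "rgg.prob ?S \<le> 0"
      by (intro tendsto_lowerbound[OF lim_1_over_n]) auto
    then have "rgg.prob ?S = 0" by (simp add: measure_le_0_iff)
    then have "?S \<in> null_sets rgg_space" using S by (intro null_setsI) (simp_all add: rgg.emeasure_eq_measure)
    from AE_not_in[OF this] show ?thesis using False by simp
  qed simp
  then have "AE \<omega> in (rgg_space :: (nat \<Rightarrow> real^'d) measure). \<forall>i j. i \<noteq> j \<longrightarrow> \<omega> i \<noteq> \<omega> j"
    by (simp add: AE_all_countable)
  then show ?thesis by (rule AE_mp) (auto simp: inj_def)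
qed

section \<open>Measurability of the events\<close>

lemma sets_has_subgraph:
  assumes V: "finite V"
  shows "{\<omega> :: nat \<Rightarrow> real^'d. has_subgraph V E (\<omega> ` {..<n}) (geo_adj r)} \<in> sets rgg_space"
proof -
  \<comment> \<open>An embedding is recorded by indices, of which there are finitely many choices.
    Injectivity is demanded of the points, since different indices may carry the same point.\<close>
  let ?Q = "\<lambda>(g :: 'a \<Rightarrow> nat) (\<omega> :: nat \<Rightarrow> real^'d). (\<forall>u\<in>V. \<forall>v\<in>V. \<omega> (g u) = \<omega> (g v) \<longrightarrow> u = v) \<and>
      (\<forall>u\<in>V. \<forall>v\<in>V. E u v \<longrightarrow> geo_adj r (\<omega> (g u)) (\<omega> (g v)))"
  have eq: "has_subgraph V E (\<omega> ` {..<n}) (geo_adj r) \<longleftrightarrow> (\<exists>g\<in>V \<rightarrow>\<^sub>E {..<n}. ?Q g \<omega>)" for \<omega>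
  proof
    assume "has_subgraph V E (\<omega> ` {..<n}) (geo_adj r)"
    then obtain f where f: "inj_on f V" "f ` V \<subseteq> \<omega> ` {..<n}" "\<forall>u\<in>V. \<forall>v\<in>V. E u v \<longrightarrow> geo_adj r (f u) (f v)"
      unfolding has_subgraph_def by blast
    then have "\<forall>v\<in>V. \<exists>p<n. f v = \<omega> p" by fastforce
    then obtain g where g: "\<forall>v\<in>V. g v < n \<and> f v = \<omega> (g v)" by metis
    show "\<exists>g\<in>V \<rightarrow>\<^sub>E {..<n}. ?Q g \<omega>"
      using f(1,3) g by (intro bexI[of _ "restrict g V"]) (auto simp: inj_on_def)
  next
    assume "\<exists>g\<in>V \<rightarrow>\<^sub>E {..<n}. ?Q g \<omega>"
    then obtain g where "g \<in> V \<rightarrow>\<^sub>E {..<n}" "?Q g \<omega>" by blast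
    then show "has_subgraph V E (\<omega> ` {..<n}) (geo_adj r)"
      unfolding has_subgraph_def by (intro exI[of _ "\<omega> \<circ> g"]) (auto simp: inj_on_def PiE_def Pi_def)
  qed
  have pairs: "{\<omega> \<in> space rgg_space. (\<omega> :: nat \<Rightarrow> real^'d) i = \<omega> j} \<in> sets rgg_space"
    "{\<omega> \<in> space rgg_space. geo_adj r ((\<omega> :: nat \<Rightarrow> real^'d) i) (\<omega> j)} \<in> sets rgg_space" for i j
    unfolding geo_adj_def by measurable
  have fin: "finite (V \<rightarrow>\<^sub>E {..<n})" using V by (intro finite_PiE) auto
  have "{\<omega> \<in> space rgg_space. \<exists>g\<in>V \<rightarrow>\<^sub>E {..<n}. ?Q g \<omega>} \<in> sets rgg_space"
    by (intro sets.sets_Collect_finite_Ex fin sets.sets_Collect_conj sets.sets_Collect_finite_All V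
      sets.sets_Collect_imp pairs sets.sets_Collect_const)
  then show ?thesis unfolding eq by simp
qed

text \<open>There are uncountably many sequences \<open>s\<close>, but the events see them only
  through a finite set of lists of naturals, and there are countably many of those.\<close>

lemma countable_bt_verts_image: "countable ((\<lambda>s. bt_verts s h) ` S)"
  by (rule countable_subset[OF _ countable_Collect_finite]) (auto simp: finite_bt_verts)

lemma event_E_sets: "(event_E r M h :: (nat \<Rightarrow> real^'d) set) \<in> sets rgg_space"
proof -
  let ?P = "\<lambda>V (\<omega> :: nat \<Rightarrow> real^'d). has_subgraph V bt_adj (\<omega> ` {..<card V}) (geo_adj r)"
  have "{\<omega> \<in> space rgg_space. \<forall>V\<in>(\<lambda>s. bt_verts s h) ` {s. balanced_M_seq M h s}. ?P V \<omega>} \<in> sets rgg_space"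
    by (intro sets.sets_Collect_countable_All' countable_bt_verts_image) (auto intro: sets_has_subgraph finite_bt_verts)
  then show ?thesis by (simp add: event_E_def rgg_contains_def)
qed

lemma event_F_sets: "(event_F r M h :: (nat \<Rightarrow> real^'d) set) \<in> sets rgg_space"
proof -
  let ?P = "\<lambda>V (\<omega> :: nat \<Rightarrow> real^'d). has_subgraph V bt_adj (\<omega> ` {..<card V}) (geo_adj r)"
  have "{\<omega> \<in> space rgg_space. \<forall>V\<in>(\<lambda>s. bt_verts s h) ` {s. balanced_M_seq M h s}. \<not> ?P V \<omega>} \<in> sets rgg_space"
    by (intro sets.sets_Collect_countable_All' countable_bt_verts_image sets.sets_Collect_neg) (auto intro: sets_has_subgraph finite_bt_verts)
  then show ?thesis by (simp add: event_F_def rgg_contains_def)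
qed

subsection \<open>Embedding balanced trees\<close>

text \<open>\<open>L\<close> is the common number of deep vertices under one vertex of layer
  \<open>j\<close>. Counting deep vertices by a property of their ancestor thus reduces to counting
  in layer \<open>j\<close>.\<close>

lemma card_bt_descendants_Collect:
  assumes "j \<le> g"
  obtains L where "\<And>Q. card {v \<in> bt_verts s h. g < length v \<and> Q (take j v)} = L * card {w \<in> bt_layer s j. Q w}"
proof
  let ?L = "card {ys. g - j < length ys \<and> j + length ys \<le> h \<and> (\<forall>i<length ys. ys ! i < s (Suc (j + i)))}"
  fix Q
  have "{v \<in> bt_verts s h. g < length v \<and> Q (take j v)} =
    (\<Union>w\<in>{w \<in> bt_layer s j. Q w}. {v \<in> bt_verts s h. g < length v \<and> take j v = w})"
    using assms by (auto intro!: take_in_bt_layer[of _ s h])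
  also have "card \<dots> = (\<Sum>w\<in>{w \<in> bt_layer s j. Q w}. card {v \<in> bt_verts s h. g < length v \<and> take j v = w})"
    by (intro card_UN_disjoint) (auto simp: finite_bt_layer finite_bt_verts)
  also have "\<dots> = (\<Sum>w\<in>{w \<in> bt_layer s j. Q w}. ?L)"
    using assms by (intro sum.cong refl card_bt_descendants) auto
  finally show "card {v \<in> bt_verts s h. g < length v \<and> Q (take j v)} = ?L * card {w \<in> bt_layer s j. Q w}"
    by (simp add: mult.commute)
qed

text \<open>The map \<open>q * K div m\<close> spreads \<open>m\<close> items in order over
  \<open>K\<close> cells. The first \<open>Suc i\<close> cells receive the ceiling of
  \<open>Suc i * m / K\<close> items, which is \<open>x\<close> in the proof, so the rounding error
  is below one item.\<close>

lemma card_scaled_prefix: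
  fixes m K i :: nat
  assumes "m > 0" "Suc i \<le> K"
  defines "C \<equiv> card {q. q < m \<and> q * K div m \<le> i}"
  shows "Suc i * m \<le> C * K" "C * K < Suc i * m + K"
proof -
  define x where "x = (Suc i * m + (K - 1)) div K"
  have K: "K > 0" using assms by simp
  have "Suc i * m + (K - 1) < (m + 1) * K"
    using mult_le_mono1[OF assms(2), of m] K by (simp add: algebra_simps)
  then have "x < m + 1" unfolding x_def by (rule less_mult_imp_div_less)
  have iff: "q * K div m \<le> i \<longleftrightarrow> q < x" for q
  proof -
    have "q * K div m \<le> i \<longleftrightarrow> q * K < Suc i * m"
      unfolding less_Suc_eq_le[symmetric] using assms(1) by (rule div_less_iff_less_mult)
    also have "\<dots> \<longleftrightarrow> Suc q * K \<le> Suc i * m + (K - 1)"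
      unfolding mult_Suc using K by linarith
    also have "\<dots> \<longleftrightarrow> q < x" unfolding x_def Suc_le_eq[symmetric] using less_eq_div_iff_mult_less_eq[OF K] by blast
    finally show ?thesis .
  qed
  have "{q. q < m \<and> q * K div m \<le> i} = {..<x}"
    unfolding iff using \<open>x < m + 1\<close> by auto
  then have C: "C = x" unfolding C_def by simp
  have "x * K + (Suc i * m + (K - 1)) mod K = Suc i * m + (K - 1)" unfolding x_def by (rule div_mult_mod_eq)
  moreover have "(Suc i * m + (K - 1)) mod K \<le> K - 1" using mod_less_divisor[OF K, of "Suc i * m + (K - 1)"] by linarith
  ultimately show "Suc i * m \<le> C * K" "C * K < Suc i * m + K" unfolding C using K by linarith+
qed

section \<open>Deterministic consequences of even point counts\<close>

context cell_order
begin

lemma prefix_count_bound: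
  assumes "\<not> deviates \<omega> n c"
  shows "\<bar>real (prefix_count \<omega> n c) * real cells - real n * (real c + 1)\<bar> < real n / 8"
proof -
  have "\<bar>real (prefix_count \<omega> n c) - real n * (real c + 1) / real cells\<bar> < real n / (8 * real cells)"
    using assms unfolding deviates_def by simp
  then have "\<bar>real (prefix_count \<omega> n c) - real n * (real c + 1) / real cells\<bar> * real cells
      < real n / (8 * real cells) * real cells"
    using cells_pos by (intro mult_strict_right_mono) auto
  then show ?thesis using cells_pos by (simp add: abs_mult_pos left_diff_distrib)
qed

text \<open>The count of a cell is a difference of two prefix counts, each off by less than
  \<open>n / (8 * cells)\<close>, which leaves three quarters of the mean. The first cell has no
  preceding prefix and is treated separately.\<close>

lemma cell_count_ge:
  assumes dev: "\<And>c. c < cells \<Longrightarrow> \<not> deviates \<omega> n c" and c: "c < cells" and n: "n > 0"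
  shows "3 * real n \<le> 4 * real cells * real (card {p. p < n \<and> \<sigma> (\<omega> p) = c})"
proof -
  let ?P = "\<lambda>c. prefix_count \<omega> n c"
  have bd: "\<bar>real (?P c) * real cells - real n * (real c + 1)\<bar> < real n / 8" if "c < cells" for c
    using prefix_count_bound[OF dev[OF that]] .
  have split: "real (card {p. p < n \<and> \<sigma> (\<omega> p) = c}) = real (?P c) - (if c = 0 then 0 else real (?P (c - 1)))"
  proof (cases "c = 0")
    case False
    have "card {p. p < n \<and> \<sigma> (\<omega> p) \<le> c} =
      card ({p. p < n \<and> \<sigma> (\<omega> p) = c} \<union> {p. p < n \<and> \<sigma> (\<omega> p) \<le> c - 1})"
      using False by (intro arg_cong[where f = card]) auto
    also have "\<dots> = card {p. p < n \<and> \<sigma> (\<omega> p) = c} + card {p. p < n \<and> \<sigma> (\<omega> p) \<le> c - 1}"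
      using False by (intro card_Un_disjoint) auto
    finally show ?thesis using False by (simp add: prefix_count_def)
  qed (simp add: prefix_count_def)
  show ?thesis
  proof (cases "c = 0")
    case True
    then have "\<bar>real (?P c) * real cells - real n\<bar> < real n / 8" using bd[OF c] by simp
    then have "3 * real n \<le> 4 * (real (?P c) * real cells)" using n by linarith
    then show ?thesis using True split by (simp add: algebra_simps)
  next
    case False
    then have "real (c - 1) = real c - 1" by simp
    then have "\<bar>real (?P (c - 1)) * real cells - real n * real c\<bar> < real n / 8"
      using bd[of "c - 1"] c by simp
    moreover have "\<bar>real (?P c) * real cells - (real n * real c + real n)\<bar> < real n / 8"
      using bd[OF c] by (simp add: distrib_left)
    moreover have "3 * z \<le> 4 * (b - a)" if "\<bar>a - x\<bar> < z / 8" "\<bar>b - (x + z)\<bar> < z / 8" for a b x z :: real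
      using that unfolding abs_less_iff by argo
    ultimately have "3 * real n \<le> 4 * (real (?P c) * real cells - real (?P (c - 1)) * real cells)"
      by blast
    then show ?thesis unfolding split using False by (simp add: algebra_simps)
  qed
qed

text \<open>An embedding uses every point, in particular one in the cell far from the image of the
  root, but a path of at most \<open>h\<close> edges does not reach that far.\<close>

lemma not_rgg_contains:
  assumes cube: "\<And>i. \<omega> i \<in> unit_cube"
    and dev: "\<And>c. c < cells \<Longrightarrow> \<not> deviates \<omega> (card (bt_verts s h)) c"
    and r: "r > 0" "real h * r < sqrt (real CARD('d)) * (1 / 2 - 1 / real k)"
  shows "\<not> rgg_contains r \<omega> (card (bt_verts s h)) s h"
proof
  let ?V = "bt_verts s h"
  let ?n = "card ?V"
  assume "rgg_contains r \<omega> ?n s h"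
  then obtain f where f: "inj_on f ?V" "f ` ?V \<subseteq> \<omega> ` {..<?n}"
    "\<And>u v. u \<in> ?V \<Longrightarrow> v \<in> ?V \<Longrightarrow> bt_adj u v \<Longrightarrow> geo_adj r (f u) (f v)"
    unfolding rgg_contains_def has_subgraph_def by blast
  have n: "?n > 0" using finite_bt_verts[of s h] Nil_in_bt_verts[of s h] unfolding card_gt_0_iff by blast
  \<comment> \<open>An injection of \<open>?n\<close> vertices into at most \<open>?n\<close> points
    is onto.\<close>
  have "card (\<omega> ` {..<?n}) \<le> card (f ` ?V)"
    using card_image_le[of "{..<?n}" \<omega>] card_image[OF f(1)] by simp
  then have onto: "f ` ?V = \<omega> ` {..<?n}" using f(2) by (intro card_seteq) auto
  have path: "dist (f []) (f v) \<le> real (length v) * r" if "v \<in> ?V" for v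
    using that
  proof (induction v rule: rev_induct)
    case (snoc c v)
    have v: "v \<in> ?V" using snoc.prems by (rule bt_verts_snoc_D)
    have "geo_adj r (f v) (f (v @ [c]))" using f(3)[OF v snoc.prems] by (auto simp: bt_adj_def)
    then have "dist (f v) (f (v @ [c])) \<le> r" by (simp add: geo_adj_def)
    then show ?case using snoc.IH[OF v] dist_triangle[of "f []" "f (v @ [c])" "f v"]
      by (simp add: algebra_simps)
  qed simp
  have "f [] \<in> \<omega> ` {..<?n}" using f(2) Nil_in_bt_verts by (rule subsetD[OF _ imageI])
  then have "f [] \<in> unit_cube" using cube by auto
  then obtain i where i: "i < cells" "\<And>y. y \<in> unit_cube \<Longrightarrow> \<sigma> y = i \<Longrightarrow>
      sqrt (real CARD('d)) * (1 / 2 - 1 / real k) \<le> dist (f []) y"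
    using far_cell by blast
  have "card {p. p < ?n \<and> \<sigma> (\<omega> p) = i} \<noteq> 0"
  proof
    assume "card {p. p < ?n \<and> \<sigma> (\<omega> p) = i} = 0"
    with cell_count_ge[OF dev i(1) n] n show False by simp
  qed
  then have "{p. p < ?n \<and> \<sigma> (\<omega> p) = i} \<noteq> {}" by (metis card.empty)
  then obtain p where p: "p < ?n" "\<sigma> (\<omega> p) = i" by blast
  then have "\<omega> p \<in> f ` ?V" unfolding onto by simp
  then obtain v where v: "v \<in> ?V" "f v = \<omega> p" by auto
  have "real (length v) * r \<le> real h * r" using v(1) r(1) by (auto simp: bt_verts_def)
  then show False using path[OF v(1)] i(2)[OF cube p(2)] v(2) r(2) by simp
qed

text \<open>\<open>r1\<close> pays for an edge in the upper layers: one of \<open>h - 2 * j\<close>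
  equal steps along at most half a diagonal, plus one cell diameter at each end. \<open>r2\<close>
  pays for an edge in the lower layers, whose ends are both within two cell diameters of the same
  target.\<close>

lemma rgg_contains_balanced:
  assumes cube: "\<And>i. \<omega> i \<in> unit_cube" and inj: "inj \<omega>"
    and s: "\<And>i. i \<in> {1..h} \<Longrightarrow> 2 \<le> s i"
    and dev: "\<And>c. c < cells \<Longrightarrow> \<not> deviates \<omega> (card (bt_verts s h)) c"
    and j: "2 * j < h" "8 * cells \<le> 2 ^ j"
    and r1: "sqrt (real CARD('d)) / (2 * real (h - 2 * j)) + 2 * sqrt (real CARD('d)) / real k \<le> r"
    and r2: "4 * sqrt (real CARD('d)) / real k \<le> r"
  shows "rgg_contains r \<omega> (card (bt_verts s h)) s h"
proof -
  define V where "V = bt_verts s h"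
  define n where "n = card V"
  define g where "g = h - j"
  define m where "m = card (bt_layer s j)"
  \<comment> \<open>\<open>I\<close> is placed greedily near prescribed locations, and
    \<open>F\<close>, the last \<open>j\<close> layers, is matched with the remaining
    points.\<close>
  define I where "I = {v \<in> V. length v \<le> g}"
  define F where "F = {v \<in> V. g < length v}"
  have finV: "finite V" unfolding V_def by (rule finite_bt_verts)
  have g: "j \<le> g" "g \<le> h" "g + j = h" using j by (auto simp: g_def)
  have m: "2 ^ j \<le> m" unfolding m_def using s j by (intro power2_le_card_bt_layer) auto
  then have m0: "m > 0" using less_le_trans[of 0 "2 ^ j" m] by simp
  have n0: "n > 0" using finV Nil_in_bt_verts[of s h] unfolding n_def V_def card_gt_0_iff by blast
  have dev': "\<not> deviates \<omega> n c" if "c < cells" for c using dev[OF that] by (simp add: n_def V_def)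
  \<comment> \<open>Each of the \<open>j\<close> layers below \<open>I\<close> at least doubles the
    tree, so \<open>I\<close> has at most an eighth of the mean count of a cell.\<close>
  have "I = bt_verts s g" using g by (auto simp: I_def V_def bt_verts_def)
  moreover have "2 ^ j * card (bt_verts s g) \<le> card (bt_verts s (g + j))"
    using s g by (intro card_bt_verts_mono_power) auto
  ultimately have "2 ^ j * card I \<le> n" using g by (simp add: n_def V_def)
  then have I8: "8 * cells * card I \<le> n" using mult_le_mono1[OF j(2), of "card I"] by linarith
  obtain L where L: "\<And>Q. card {v \<in> bt_verts s h. g < length v \<and> Q (take j v)} = L * card {w \<in> bt_layer s j. Q w}"
    using card_bt_descendants_Collect[OF g(1)] by blast
  have cardF: "card F = L * m" using L[of "\<lambda>_. True"] by (simp add: F_def V_def m_def)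
  have VIF: "V = I \<union> F" "I \<inter> F = {}" by (auto simp: I_def F_def)
  have finIF: "finite I" "finite F" using finV by (auto simp: I_def F_def)
  have nIF: "n = card I + card F" unfolding n_def VIF(1) using VIF(2) finIF by (intro card_Un_disjoint)
  \<comment> \<open>\<open>F\<close> splits into at least \<open>2 ^ j\<close> blocks of size
    \<open>L\<close>, so a rounding error of one block is again at most an eighth of the mean
    count.\<close>
  have "8 * cells * L \<le> m * L" using j(2) m by (intro mult_le_mono1) linarith
  also have "\<dots> \<le> n" using cardF nIF by (simp add: mult.commute)
  finally have L8: "8 * cells * L \<le> n" .

  obtain rk where rk: "bij_betw rk (bt_layer s j) {0..<m}"
    using ex_bij_betw_finite_nat[OF finite_bt_layer] unfolding m_def by blast
  \<comment> \<open>The target cell of the subtree at \<open>w\<close>; the numbering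
    \<open>rk\<close> of layer \<open>j\<close> is arbitrary.\<close>
  define \<tau> where "\<tau> w = rk w * cells div m" for w
  have \<tau>_less: "\<tau> w < cells" if "w \<in> bt_layer s j" for w
  proof -
    have "rk w < m" using rk that by (auto simp: bij_betw_def)
    then have "rk w * cells < cells * m" using cells_pos by (simp add: mult.commute)
    then show ?thesis unfolding \<tau>_def by (rule less_mult_imp_div_less)
  qed
  have card_\<tau>: "card {w \<in> bt_layer s j. \<tau> w \<le> i} = card {q. q < m \<and> q * cells div m \<le> i}" for i
  proof -
    have "{q. q < m \<and> q * cells div m \<le> i} = {q \<in> rk ` bt_layer s j. q * cells div m \<le> i}"
      using rk by (auto simp: bij_betw_def)
    also have "\<dots> = rk ` {w \<in> bt_layer s j. \<tau> w \<le> i}" by (auto simp: \<tau>_def)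
    finally have "{q. q < m \<and> q * cells div m \<le> i} = rk ` {w \<in> bt_layer s j. \<tau> w \<le> i}" .
    moreover have "inj_on rk {w \<in> bt_layer s j. \<tau> w \<le> i}"
      using rk by (auto simp: bij_betw_def intro: inj_on_subset)
    ultimately show ?thesis by (simp add: card_image)
  qed

  \<comment> \<open>A target point in every cell. Numbers that are no cells get an arbitrary point
    of the cube, so that \<open>loc\<close> is meaningful also for vertices above layer
    \<open>j\<close>, where \<open>take j v\<close> lies outside the layer.\<close>
  have "\<exists>x. x \<in> unit_cube \<and> (c < cells \<longrightarrow> \<sigma> x = c)" for c
  proof (cases "c < cells")
    case True
    have "card {p. p < n \<and> \<sigma> (\<omega> p) = c} \<noteq> 0"
    proof
      assume "card {p. p < n \<and> \<sigma> (\<omega> p) = c} = 0"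
      with cell_count_ge[OF dev' True n0] n0 show False by simp
    qed
    then have "{p. p < n \<and> \<sigma> (\<omega> p) = c} \<noteq> {}" by (metis card.empty)
    then obtain p where "\<sigma> (\<omega> p) = c" by blast
    then show ?thesis using cube by blast
  qed (use cube in blast)
  then obtain P where P: "\<And>c. P c \<in> unit_cube" "\<And>c. c < cells \<Longrightarrow> \<sigma> (P c) = c" by metis
  define ctr :: "real^'d" where "ctr = (\<chi> i. 1 / 2)"
  \<comment> \<open>Truncated subtraction keeps \<open>t\<close> at 0 through layer
    \<open>j\<close>; it then grows linearly and reaches 1 at layer \<open>g\<close>.\<close>
  define t where "t l = real (l - j) / real (h - 2 * j)" for l
  define loc where "loc v = ctr + t (length v) *\<^sub>R (P (\<tau> (take j v)) - ctr)" for v :: "nat list"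
  have hj: "real (h - 2 * j) > 0" using j by simp
  have t01: "0 \<le> t l" "l \<le> g \<Longrightarrow> t l \<le> 1" for l using hj j unfolding t_def g_def
    by (auto simp: field_simps simp flip: of_nat_diff)
  have tg: "t g = 1" unfolding t_def g_def using j by auto
  have loc_cube: "loc v \<in> unit_cube" if "length v \<le> g" for v
  proof -
    have "ctr \<in> unit_cube" by (simp add: unit_cube_def ctr_def)
    then have "(1 - t (length v)) *\<^sub>R ctr + t (length v) *\<^sub>R P (\<tau> (take j v)) \<in> unit_cube"
      using P(1) t01[of "length v"] that
      by (intro convexD[OF convex_box(1)[of 0 "1 :: real^'d", folded unit_cube_eq_cbox]]) auto
    then show ?thesis by (simp add: loc_def algebra_simps)
  qed
  have loc_step: "dist (loc v) (loc (v @ [c])) \<le> sqrt (real CARD('d)) / (2 * real (h - 2 * j))" for v c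
  proof (cases "length v < j")
    case True
    then have "loc v = loc (v @ [c])" by (simp add: loc_def t_def)
    then show ?thesis using hj by simp
  next
    case False
    let ?p = "P (\<tau> (take j v)) - ctr"
    have tk: "take j (v @ [c]) = take j v" using False by simp
    have "real (Suc (length v) - j) = real (length v - j) + 1" using False by (simp add: Suc_diff_le)
    then have tt: "t (Suc (length v)) = t (length v) + 1 / real (h - 2 * j)"
      by (simp add: t_def add_divide_distrib)
    have "dist (loc v) (loc (v @ [c])) = norm ((1 / real (h - 2 * j)) *\<^sub>R ?p)"
      unfolding loc_def tk dist_norm by (simp add: tt algebra_simps norm_minus_commute)
    also have "\<dots> = norm ?p / real (h - 2 * j)" using hj by simp
    finally have eq: "dist (loc v) (loc (v @ [c])) = norm ?p / real (h - 2 * j)" .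
    have "norm ?p \<le> sqrt (real CARD('d)) * (1 / 2)"
      unfolding dist_norm[symmetric]
    proof (rule dist_cart_le)
      fix i
      show "\<bar>P (\<tau> (take j v)) $ i - ctr $ i\<bar> \<le> 1 / 2"
        using P(1)[of "\<tau> (take j v)"] unfolding abs_le_iff by (simp add: unit_cube_def ctr_def)
    qed
    then have "norm ?p / real (h - 2 * j) \<le> sqrt (real CARD('d)) * (1 / 2) / real (h - 2 * j)"
      using hj by (intro divide_right_mono) auto
    then show ?thesis unfolding eq by simp
  qed

  have real_ineqs: "8 * real cells * real (card I) \<le> real n" "8 * real cells * real L \<le> real n"
    using I8 L8 by (metis of_nat_le_iff of_nat_mult of_nat_numeral)+
  \<comment> \<open>Each cell contains more than enough points to take all of
    \<open>I\<close>.\<close>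
  have "\<exists>e. inj_on e I \<and> e ` I \<subseteq> {..<n} \<and> (\<forall>v\<in>I. \<sigma> (\<omega> (e v)) = \<sigma> (loc v))"
  proof (rule inj_lifting[OF finIF(1)])
    fix v
    have "3 * real n \<le> 4 * real cells * real (card {p. p < n \<and> \<sigma> (\<omega> p) = \<sigma> (loc v)})"
      by (rule cell_count_ge[OF dev' less n0])
    then have "4 * real cells * real (card I) \<le> 4 * real cells * real (card {p. p < n \<and> \<sigma> (\<omega> p) = \<sigma> (loc v)})"
      using real_ineqs(1) by linarith
    then show "card I \<le> card {b \<in> {..<n}. \<sigma> (\<omega> b) = \<sigma> (loc v)}" using cells_pos by simp
  qed simp
  then obtain e1 where e1: "inj_on e1 I" "e1 ` I \<subseteq> {..<n}" "\<And>v. v \<in> I \<Longrightarrow> \<sigma> (\<omega> (e1 v)) = \<sigma> (loc v)" by blast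
  define R where "R = {..<n} - e1 ` I"
  have cardR: "card R = card F"
    unfolding R_def using e1(1,2) nIF finIF by (simp add: card_Diff_subset card_image)
  have prefix: "real n * (real i + 1) - real n / 8 \<le> real (prefix_count \<omega> n i) * real cells"
    "real (prefix_count \<omega> n i) * real cells \<le> real n * (real i + 1) + real n / 8" if "i < cells" for i
  proof -
    have "\<bar>real (prefix_count \<omega> n i) * real cells - real n * (real i + 1)\<bar> < real n / 8"
      by (rule prefix_count_bound[OF dev'[OF that]])
    then show "real n * (real i + 1) - real n / 8 \<le> real (prefix_count \<omega> n i) * real cells"
      "real (prefix_count \<omega> n i) * real cells \<le> real n * (real i + 1) + real n / 8" by linarith+
  qed
  have R_le: "card {b \<in> R. \<sigma> (\<omega> b) \<le> i} \<le> prefix_count \<omega> n i" for i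
    unfolding prefix_count_def R_def by (intro card_mono) auto
  \<comment> \<open>The greedy placement removes at most \<open>card I\<close> points from any
    initial segment, wherever they lie.\<close>
  have R_ge: "prefix_count \<omega> n i \<le> card {b \<in> R. \<sigma> (\<omega> b) \<le> i} + card I" for i
  proof -
    have "prefix_count \<omega> n i \<le> card ({b \<in> R. \<sigma> (\<omega> b) \<le> i} \<union> e1 ` I)"
      unfolding prefix_count_def R_def using finIF(1) by (intro card_mono) auto
    also have "\<dots> \<le> card {b \<in> R. \<sigma> (\<omega> b) \<le> i} + card (e1 ` I)" by (rule card_Un_le)
    finally show ?thesis using card_image[OF e1(1)] by simp
  qed
  have F_count: "card {v \<in> F. \<tau> (take j v) \<le> i} = L * card {q. q < m \<and> q * cells div m \<le> i}" for i
    using L[of "\<lambda>w. \<tau> w \<le> i"] card_\<tau>[of i] by (simp add: F_def V_def conj_assoc)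
  have F_all: "{v \<in> F. \<tau> (take j v) \<le> i} = F" if "cells \<le> Suc i" for i
  proof -
    have "\<tau> (take j v) < cells" if "v \<in> F" for v
      using that g by (intro \<tau>_less take_in_bt_layer[of _ s h]) (auto simp: F_def V_def)
    then show ?thesis using that by fastforce
  qed
  have R_all: "{b \<in> R. \<sigma> (\<omega> b) \<le> i} = R" if "cells \<le> Suc i" for i
    using less_le_trans[OF less that] by (auto simp: less_Suc_eq_le)
  \<comment> \<open>Passing to the next cell gains \<open>n\<close> after multiplication by
    \<open>cells\<close>. This absorbs three errors of at most \<open>n / 8\<close>: the rounding,
    the deviation of the counts and the points used by \<open>I\<close>.\<close>
  have FR: "card {v \<in> F. \<tau> (take j v) \<le> i} \<le> card {b \<in> R. \<sigma> (\<omega> b) \<le> Suc i}" for i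
  proof (cases "Suc i < cells")
    case False
    then have "card {b \<in> R. \<sigma> (\<omega> b) \<le> Suc i} = card F" using R_all[of "Suc i"] cardR by simp
    then show ?thesis using finIF(2) by (simp add: card_mono)
  next
    case True
    define C where "C = card {q. q < m \<and> q * cells div m \<le> i}"
    have "C * cells \<le> Suc i * m + cells" unfolding C_def using card_scaled_prefix(2)[OF m0, of i cells] True by simp
    then have "L * (C * cells) \<le> L * (Suc i * m + cells)" by (rule mult_le_mono2)
    also have "\<dots> = Suc i * card F + L * cells" unfolding cardF by (simp add: algebra_simps)
    also have "\<dots> \<le> Suc i * n + L * cells" using nIF by (intro add_right_mono mult_le_mono2) simp
    finally have "real (L * (C * cells)) \<le> real (Suc i * n + L * cells)" by (rule of_nat_mono)
    then have "real (L * C) * real cells \<le> (real i + 1) * real n + real L * real cells" by (simp add: algebra_simps)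
    also have "\<dots> \<le> real n * (real (Suc i) + 1) - real n / 8 - real cells * real (card I)"
      using real_ineqs by (simp add: algebra_simps)
    also have "\<dots> \<le> real (prefix_count \<omega> n (Suc i)) * real cells - real cells * real (card I)"
      using prefix(1)[OF True] by simp
    also have "\<dots> = (real (prefix_count \<omega> n (Suc i)) - real (card I)) * real cells" by (simp add: algebra_simps)
    also have "\<dots> \<le> real (card {b \<in> R. \<sigma> (\<omega> b) \<le> Suc i}) * real cells"
      using R_ge[of "Suc i"] by (intro mult_right_mono) auto
    finally show ?thesis unfolding F_count C_def[symmetric] using cells_pos by (simp flip: of_nat_mult)
  qed
  \<comment> \<open>The mirror image of \<open>FR\<close>. The ceiling now rounds in the favourable
    direction, and \<open>Suc (Suc i) \<le> cells\<close> bounds the loss from replacing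
    \<open>n\<close> by \<open>card F\<close>.\<close>
  have RF: "card {b \<in> R. \<sigma> (\<omega> b) \<le> i} \<le> card {v \<in> F. \<tau> (take j v) \<le> Suc i}" for i
  proof (cases "Suc i < cells")
    case False
    then have "card {v \<in> F. \<tau> (take j v) \<le> Suc i} = card R" using F_all[of "Suc i"] cardR by simp
    moreover have "card {b \<in> R. \<sigma> (\<omega> b) \<le> i} \<le> card R" by (intro card_mono) (auto simp: R_def)
    ultimately show ?thesis by simp
  next
    case True
    define C where "C = card {q. q < m \<and> q * cells div m \<le> Suc i}"
    have "Suc (Suc i) * m \<le> C * cells" unfolding C_def using card_scaled_prefix(1)[OF m0, of "Suc i" cells] True by simp
    then have "L * (Suc (Suc i) * m) \<le> L * (C * cells)" by (rule mult_le_mono2)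
    then have "Suc (Suc i) * card F \<le> L * C * cells" unfolding cardF by (simp add: algebra_simps)
    then have "Suc (Suc i) * n \<le> L * C * cells + Suc (Suc i) * card I" unfolding nIF by (simp add: algebra_simps)
    also have "\<dots> \<le> L * C * cells + cells * card I" using True by (intro add_left_mono mult_le_mono1) simp
    finally have "real (Suc (Suc i) * n) \<le> real (L * C * cells + cells * card I)" by (rule of_nat_mono)
    then have lo: "(real i + 2) * real n \<le> real (L * C) * real cells + real cells * real (card I)"
      by (simp add: algebra_simps)
    have "real (card {b \<in> R. \<sigma> (\<omega> b) \<le> i}) * real cells \<le> real (prefix_count \<omega> n i) * real cells"
      using R_le[of i] by (intro mult_right_mono) auto
    also have "\<dots> \<le> real n * (real i + 1) + real n / 8" using True by (intro prefix(2)) simp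
    also have "\<dots> \<le> real (L * C) * real cells" using lo real_ineqs(1) by (simp add: algebra_simps)
    finally show ?thesis unfolding F_count C_def[symmetric] using cells_pos by (simp flip: of_nat_mult)
  qed
  have "\<exists>e. bij_betw e F R \<and> (\<forall>v\<in>F. \<sigma> (\<omega> (e v)) \<le> Suc (\<tau> (take j v)) \<and> \<tau> (take j v) \<le> Suc (\<sigma> (\<omega> (e v))))"
    by (rule monotone_matching) (use finIF cardR FR RF in \<open>auto simp: R_def\<close>)
  then obtain e2 where e2: "bij_betw e2 F R"
    "\<And>v. v \<in> F \<Longrightarrow> \<sigma> (\<omega> (e2 v)) \<le> Suc (\<tau> (take j v)) \<and> \<tau> (take j v) \<le> Suc (\<sigma> (\<omega> (e2 v)))" by blast
  define e where "e v = (if length v \<le> g then e1 v else e2 v)" for v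
  have e_eq: "e v = e1 v" if "v \<in> I" for v using that by (simp add: e_def I_def)
  have e_eq': "e v = e2 v" if "v \<in> F" for v using that by (simp add: e_def F_def)
  have e_image: "e ` I = e1 ` I" "e ` F = R"
    using e2(1) by (simp_all add: e_eq e_eq' bij_betw_def cong: image_cong)
  have "inj_on e I" using e1(1) e_eq by (simp cong: inj_on_cong)
  moreover have "inj_on e F" using e2(1) e_eq' unfolding bij_betw_def by (simp cong: inj_on_cong)
  ultimately have e_inj: "inj_on e V"
    unfolding VIF(1) inj_on_Un using VIF(2) e_image by (auto simp: R_def Diff_triv Int_commute)
  have e_im: "e ` V \<subseteq> {..<n}"
    unfolding VIF(1) image_Un e_image using e1(2) by (auto simp: R_def)
  let ?x = "\<lambda>v. \<omega> (e v)"
  have near_loc: "dist (?x v) (loc v) \<le> sqrt (real CARD('d)) / real k" if "v \<in> V" "length v \<le> g" for v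
    using e1(3)[of v] that cube loc_cube[of v] by (intro dist_same) (auto simp: e_def I_def)
  \<comment> \<open>Layer \<open>g\<close> is included although it belongs to \<open>I\<close>:
    there \<open>loc\<close> is already the target point. This covers the edges between layers
    \<open>g\<close> and \<open>Suc g\<close>.\<close>
  have near_target: "dist (?x v) (P (\<tau> (take j v))) \<le> 2 * sqrt (real CARD('d)) / real k"
    if "v \<in> V" "g \<le> length v" for v
  proof -
    have "take j v \<in> bt_layer s j" using that g by (intro take_in_bt_layer[of _ s h]) (auto simp: V_def)
    then have \<sigma>P: "\<sigma> (P (\<tau> (take j v))) = \<tau> (take j v)" using \<tau>_less P(2) by blast
    have "\<sigma> (?x v) \<le> Suc (\<tau> (take j v)) \<and> \<tau> (take j v) \<le> Suc (\<sigma> (?x v))"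
    proof (cases "length v = g")
      case True
      then have "loc v = P (\<tau> (take j v))" by (simp add: loc_def tg)
      then show ?thesis using e1(3)[of v] that True \<sigma>P by (simp add: e_def I_def)
    next
      case False
      then show ?thesis using e2(2)[of v] that by (simp add: e_def F_def)
    qed
    then show ?thesis using cube P(1) \<sigma>P by (intro dist_next) auto
  qed
  have edge: "dist (?x v) (?x (v @ [c])) \<le> r" if vc: "v @ [c] \<in> V" for v c
  proof -
    have v: "v \<in> V" using vc bt_verts_snoc_D by (auto simp: V_def)
    show ?thesis
    \<comment> \<open>Either both ends lie in \<open>I\<close> and follow \<open>loc\<close>, or
      both are at depth at least \<open>g\<close> and share the ancestor in layer \<open>j\<close>,
      hence the target.\<close>
    proof (cases "length v < g")
      case True
      have "dist (?x v) (?x (v @ [c])) \<le> dist (?x v) (loc v) + dist (loc v) (loc (v @ [c])) + dist (?x (v @ [c])) (loc (v @ [c]))"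
        using dist_triangle[of "?x v" "?x (v @ [c])" "loc v"] dist_triangle[of "loc v" "?x (v @ [c])" "loc (v @ [c])"]
        by (simp add: dist_commute)
      then show ?thesis using near_loc[OF v] near_loc[OF vc] loc_step[of v c] r1 True by simp
    next
      case False
      have tk: "take j (v @ [c]) = take j v" using False g by simp
      have "dist (?x v) (?x (v @ [c])) \<le> dist (?x v) (P (\<tau> (take j v))) + dist (?x (v @ [c])) (P (\<tau> (take j v)))"
        using dist_triangle[of "?x v" "?x (v @ [c])" "P (\<tau> (take j v))"] by (simp add: dist_commute)
      then show ?thesis using near_target[OF v] near_target[OF vc] r2 False unfolding tk by simp
    qed
  qed
  have "geo_adj r (?x u) (?x v)" if "u \<in> V" "v \<in> V" "bt_adj u v" for u v
  proof -
    have "u \<noteq> v" using that(3) by (auto simp: bt_adj_def)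
    then have "?x u \<noteq> ?x v" using inj e_inj that by (auto simp: inj_def inj_on_def)
    moreover have "dist (?x u) (?x v) \<le> r"
      using that edge[of u] edge[of v] by (auto simp: bt_adj_def dist_commute)
    ultimately show ?thesis by (simp add: geo_adj_def)
  qed
  moreover have "inj_on (\<omega> \<circ> e) V" using e_inj inj by (intro comp_inj_on) (auto intro: inj_on_subset)
  ultimately show ?thesis
    unfolding rgg_contains_def has_subgraph_def V_def[symmetric] n_def[symmetric]
    using e_im by (intro exI[of _ "\<omega> \<circ> e"]) auto
qed

end

subsection \<open>The threshold\<close>

text \<open>\<open>B h\<close> is a bad event of vanishing probability outside which
  \<open>A h\<close> holds almost surely. The almost sure form leaves room for points outside the
  cube and for coinciding points.\<close>

lemma rgg_prob_tendsto_1: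
  fixes A B :: "nat \<Rightarrow> (nat \<Rightarrow> real^'d) set"
  assumes sets: "\<And>h. A h \<in> sets rgg_space" "\<And>h. B h \<in> sets rgg_space"
    and sub: "\<forall>\<^sub>F h in sequentially. AE \<omega> in rgg_space. \<omega> \<notin> B h \<longrightarrow> \<omega> \<in> A h"
    and le: "\<forall>\<^sub>F h in sequentially. rgg.prob (B h) \<le> b h"
    and lim: "b \<longlonglongrightarrow> 0"
  shows "(\<lambda>h. rgg.prob (A h)) \<longlonglongrightarrow> 1"
proof (rule tendsto_sandwich)
  show "(\<lambda>h. 1 - b h) \<longlonglongrightarrow> 1" using tendsto_diff[OF tendsto_const lim, of 1] by simp
  show "\<forall>\<^sub>F h in sequentially. 1 - b h \<le> rgg.prob (A h)"
    using sub le
  proof eventually_elim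
    case (elim h)
    have "1 - b h \<le> 1 - rgg.prob (B h)" using elim(2) by simp
    also have "\<dots> = rgg.prob (UNIV - B h)" using rgg.prob_compl[OF sets(2)[of h]] by simp
    also have "\<dots> \<le> rgg.prob (A h)"
      using elim(1) sets by (intro rgg.finite_measure_mono_AE) auto
    finally show ?case .
  qed
qed auto

section \<open>Choice of the parameters and passage to the limit\<close>

lemma card_bt_verts_balanced:
  "balanced_M_seq M h s \<Longrightarrow> 2 ^ h \<le> card (bt_verts s h)"
  by (rule power2_le_card_bt_verts) (simp add: balanced_M_seq_def)

lemma (in cell_order) not_deviates:
  "\<omega> \<notin> deviation_event N \<Longrightarrow> N \<le> n \<Longrightarrow> c < cells \<Longrightarrow> \<not> deviates \<omega> n c"
  by (auto simp: deviation_event_def)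

lemma event_F_limit:
  fixes \<epsilon> :: real and r :: "nat \<Rightarrow> real"
  assumes eps: "0 < \<epsilon>" and rpos: "\<forall>h\<ge>1. 0 < r h"
    and r: "\<forall>h\<ge>1. r h \<le> (1 - \<epsilon>) * (sqrt (real CARD('d)) / (2 * real h))"
  shows "(\<lambda>h. measure (rgg_space :: (nat \<Rightarrow> real^'d) measure) (event_F (r h) (M h) h)) \<longlonglongrightarrow> 1"
proof -
  \<comment> \<open>A grid independent of \<open>h\<close> suffices:
    \<open>2 / \<epsilon> < k\<close> gives
    \<open>(1 - \<epsilon>) / 2 < 1 / 2 - 1 / k\<close>.\<close>
  define k where "k = nat \<lceil>2 / \<epsilon>\<rceil> + 2"
  have k: "k > 1" "2 / \<epsilon> < real k" unfolding k_def by linarith+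
  obtain \<sigma> :: "real^'d \<Rightarrow> nat" where "cell_order k (k ^ CARD('d)) \<sigma>"
    using cell_order_exists[OF k(1)] by blast
  then interpret cell_order k "k ^ CARD('d)" \<sigma> .
  define K where "K = real (k ^ CARD('d))"
  have K: "K > 0" using cells_pos by (simp add: K_def)
  show ?thesis
  proof (rule rgg_prob_tendsto_1)
    show "(event_F (r h) (M h) h :: (nat \<Rightarrow> real^'d) set) \<in> sets rgg_space" for h by (rule event_F_sets)
    show "deviation_event (2 ^ h) \<in> sets rgg_space" for h by (rule deviation_event_sets)
    show "\<forall>\<^sub>F h in sequentially. rgg.prob (deviation_event (2 ^ h)) \<le> 128 * K ^ 3 * exp (- (2 ^ h) / (32 * K\<^sup>2))"
    proof (rule always_eventually, rule allI)
      show "rgg.prob (deviation_event (2 ^ h)) \<le> 128 * K ^ 3 * exp (- (2 ^ h) / (32 * K\<^sup>2))" for h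
        using prob_deviation_event_le[of "2 ^ h"] by (simp add: K_def)
    qed
    show "(\<lambda>h. 128 * K ^ 3 * exp (- (2 ^ h) / (32 * K\<^sup>2))) \<longlonglongrightarrow> 0"
      using K by real_asymp
    show "\<forall>\<^sub>F h in sequentially. AE \<omega> in rgg_space. \<omega> \<notin> deviation_event (2 ^ h) \<longrightarrow> \<omega> \<in> event_F (r h) (M h) h"
      using eventually_ge_at_top[of 1]
    proof eventually_elim
      case (elim h)
      show ?case using AE_rgg_unit_cube
      proof eventually_elim
        case (elim \<omega>)
        have h1: "h \<ge> 1" using \<open>1 \<le> h\<close> .
        have "real h * r h \<le> real h * ((1 - \<epsilon>) * (sqrt (real CARD('d)) / (2 * real h)))"
          using r h1 by (intro mult_left_mono) auto
        also have "\<dots> = sqrt (real CARD('d)) * ((1 - \<epsilon>) / 2)" using h1 by simp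
        also have "\<dots> < sqrt (real CARD('d)) * (1 / 2 - 1 / real k)"
          using k eps by (intro mult_strict_left_mono) (auto simp: field_simps)
        finally have hr: "real h * r h < sqrt (real CARD('d)) * (1 / 2 - 1 / real k)" .
        show ?case
        proof (intro impI)
          assume \<omega>: "\<omega> \<notin> deviation_event (2 ^ h)"
          have "\<not> rgg_contains (r h) \<omega> (card (bt_verts s h)) s h" if "balanced_M_seq (M h) h s" for s
            using not_deviates[OF \<omega> card_bt_verts_balanced[OF that]] elim rpos h1 hr
            by (intro not_rgg_contains) auto
          then show "\<omega> \<in> event_F (r h) (M h) h" by (simp add: event_F_def)
        qed
      qed
    qed
  qed
qed

text \<open>With \<open>B\<close> the threshold radius, \<open>j \<le> \<epsilon> * h / 8\<close>
  lengthens the walking step to at most \<open>B * (1 + \<epsilon> / 2)\<close>, and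
  \<open>c \<ge> 16 / \<epsilon>\<close> makes a cell diameter at most
  \<open>B * \<epsilon> / 8\<close>. Two diameters still fit below
  \<open>B * (1 + \<epsilon>)\<close>.\<close>

lemma radius_bounds:
  fixes \<epsilon> D r :: real and h j c :: nat
  assumes eps: "0 < \<epsilon>" "\<epsilon> < 1" and h: "h > 0" and D: "0 \<le> D"
    and c: "16 / \<epsilon> \<le> real c" and j: "real j \<le> \<epsilon> * real h / 8"
    and r: "(1 + \<epsilon>) * (D / (2 * real h)) \<le> r"
  shows "2 * j < h" "D / (2 * real (h - 2 * j)) + 2 * D / real (c * h) \<le> r" "4 * D / real (c * h) \<le> r"
proof -
  have c0: "real c > 0" using c eps by (smt (verit) divide_pos_pos)
  have h0: "real h > 0" using h by simp
  have "real j \<le> real h / 8" using j eps h0 by (smt (verit) mult_left_le_one_le divide_right_mono)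
  then show j2: "2 * j < h" using h0 by linarith
  then have e: "real (h - 2 * j) = real h - 2 * real j" by (simp add: of_nat_diff)
  define B where "B = D / (2 * real h)"
  have B: "0 \<le> B" using D h0 by (simp add: B_def)
  have ic: "1 / real c \<le> \<epsilon> / 16" using c c0 eps by (simp add: field_simps)
  have "D / real (c * h) = 2 * B * (1 / real c)" using h0 by (simp add: B_def)
  also have "\<dots> \<le> 2 * B * (\<epsilon> / 16)" using ic B by (intro mult_left_mono) auto
  finally have t1: "D / real (c * h) \<le> B * \<epsilon> / 8" by simp
  have pos: "real h * (1 - \<epsilon> / 4) > 0" using h0 eps by simp
  have "real h * (1 - \<epsilon> / 4) \<le> real (h - 2 * j)" unfolding e using j by (simp add: algebra_simps)
  then have "D / (2 * real (h - 2 * j)) \<le> D / (2 * (real h * (1 - \<epsilon> / 4)))"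
    using D pos by (intro divide_left_mono) auto
  also have "\<dots> = B * (1 / (1 - \<epsilon> / 4))" by (simp add: B_def)
  also have "\<dots> \<le> B * (1 + \<epsilon> / 2)"
  proof (rule mult_left_mono[OF _ B])
    have "\<epsilon> * \<epsilon> \<le> \<epsilon> * 1" using eps by (intro mult_left_mono) auto
    then have "1 \<le> (1 + \<epsilon> / 2) * (1 - \<epsilon> / 4)" using eps by (simp add: algebra_simps)
    then show "1 / (1 - \<epsilon> / 4) \<le> 1 + \<epsilon> / 2" using eps by (simp add: divide_le_eq)
  qed
  finally have t2: "D / (2 * real (h - 2 * j)) \<le> B + B * \<epsilon> / 2" by (simp add: algebra_simps)
  have B\<epsilon>: "0 \<le> B * \<epsilon>" using B eps by simp
  have r': "B + B * \<epsilon> \<le> r" using r[folded B_def] by (simp add: algebra_simps)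
  have "2 * D / real (c * h) \<le> B * \<epsilon> / 4" "4 * D / real (c * h) \<le> B * \<epsilon> / 2"
    using t1 by (simp_all add: mult.commute)
  moreover have "x + y \<le> r \<and> z \<le> r"
    if "x \<le> B + B * \<epsilon> / 2" "y \<le> B * \<epsilon> / 4" "z \<le> B * \<epsilon> / 2" for x y z
    using that r' B\<epsilon> B by simp
  ultimately show "D / (2 * real (h - 2 * j)) + 2 * D / real (c * h) \<le> r" "4 * D / real (c * h) \<le> r"
    using t2 by blast+
qed

lemma event_E_limit:
  fixes \<epsilon> :: real and r :: "nat \<Rightarrow> real"
  assumes eps: "0 < \<epsilon>" "\<epsilon> < 1"
    and r: "\<forall>h\<ge>1. r h \<ge> (1 + \<epsilon>) * (sqrt (real CARD('d)) / (2 * real h))"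
  shows "(\<lambda>h. measure (rgg_space :: (nat \<Rightarrow> real^'d) measure) (event_E (r h) (M h) h)) \<longlonglongrightarrow> 1"
proof -
  define d where "d = CARD('d)"
  define c where "c = nat \<lceil>16 / \<epsilon>\<rceil> + 2"
  have c: "16 / \<epsilon> \<le> real c" "c > 1" unfolding c_def by linarith+
  \<comment> \<open>This is \<open>c * h\<close> for positive \<open>h\<close> but stays above 1 at
    \<open>h = 0\<close>, so that a cell order exists for every \<open>h\<close> and one
    interpretation covers them all.\<close>
  define k where "k h = c * Suc (h - 1)" for h
  have k1: "k h > 1" for h unfolding k_def using c(2) by (simp add: less_le_trans)
  have kh: "k h = c * h" if "h \<ge> 1" for h using that by (simp add: k_def)
  have "\<forall>h. \<exists>\<sigma> :: real^'d \<Rightarrow> nat. cell_order (k h) (k h ^ CARD('d)) \<sigma>"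
    using cell_order_exists k1 by blast
  then obtain \<sigma> :: "nat \<Rightarrow> real^'d \<Rightarrow> nat" where \<sigma>: "\<And>h. cell_order (k h) (k h ^ CARD('d)) (\<sigma> h)" by metis
  interpret cell_order "k h" "k h ^ CARD('d)" "\<sigma> h" for h by (rule \<sigma>)
  define b :: "nat \<Rightarrow> real" where
    "b h = 128 * (real c * real h) ^ (3 * d) * exp (- (2 ^ h) / (32 * (real c * real h) ^ (2 * d)))" for h
  define j where "j h = nat \<lfloor>\<epsilon> * real h / 8\<rfloor>" for h
  have j_le: "real (j h) \<le> \<epsilon> * real h / 8" "\<epsilon> * real h / 8 - 1 \<le> real (j h)" for h
  proof -
    have "0 \<le> \<epsilon> * real h / 8" using eps by simp
    then have "real (j h) = of_int \<lfloor>\<epsilon> * real h / 8\<rfloor>" by (simp add: j_def)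
    then show "real (j h) \<le> \<epsilon> * real h / 8" "\<epsilon> * real h / 8 - 1 \<le> real (j h)" by linarith+
  qed
  have c0: "real c > 0" using c(2) by simp
  \<comment> \<open>The number of cells is polynomial in \<open>h\<close> while
    \<open>2 ^ j h\<close> is exponential; the subtracted 1 accounts for the floor in
    \<open>j\<close>.\<close>
  have ev: "\<forall>\<^sub>F h in sequentially. 8 * (real c * real h) ^ d \<le> 2 powr (\<epsilon> * real h / 8 - 1)"
    using eps c0 by real_asymp
  show ?thesis
  proof (rule rgg_prob_tendsto_1)
    show "(event_E (r h) (M h) h :: (nat \<Rightarrow> real^'d) set) \<in> sets rgg_space" for h by (rule event_E_sets)
    show "deviation_event h (2 ^ h) \<in> sets rgg_space" for h by (rule deviation_event_sets)
    show "\<forall>\<^sub>F h in sequentially. rgg.prob (deviation_event h (2 ^ h)) \<le> b h"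
      using eventually_ge_at_top[of 1]
    proof eventually_elim
      case (elim h)
      have "real (k h ^ CARD('d)) = (real c * real h) ^ d" using kh[OF elim] by (simp add: d_def)
      then show ?case using prob_deviation_event_le[of "2 ^ h" h]
        by (simp add: b_def power_mult[symmetric] mult.commute)
    qed
    show "b \<longlonglongrightarrow> 0" unfolding b_def using c0 by real_asymp
    show "\<forall>\<^sub>F h in sequentially. AE \<omega> in rgg_space. \<omega> \<notin> deviation_event h (2 ^ h) \<longrightarrow> \<omega> \<in> event_E (r h) (M h) h"
      using eventually_ge_at_top[of 1] ev
    proof eventually_elim
      case (elim h)
      have h1: "h \<ge> 1" using elim(1) .
      have "8 * (real c * real h) ^ d \<le> 2 powr real (j h)"
        using elim(2) j_le(2)[of h] powr_mono[of "\<epsilon> * real h / 8 - 1" "real (j h)" 2] by linarith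
      then have "real (8 * k h ^ CARD('d)) \<le> real (2 ^ j h)"
        using kh[OF h1] by (simp add: powr_realpow d_def)
      then have jk: "8 * k h ^ CARD('d) \<le> 2 ^ j h" by (simp only: of_nat_le_iff)
      note rb = radius_bounds[OF eps _ _ c(1) j_le(1)[of h], of "sqrt (real CARD('d))" "r h"]
      show ?case using AE_rgg_unit_cube AE_rgg_inj
      proof eventually_elim
        case (elim \<omega>)
        show ?case
        proof (intro impI)
          assume \<omega>: "\<omega> \<notin> deviation_event h (2 ^ h)"
          have "rgg_contains (r h) \<omega> (card (bt_verts s h)) s h" if s: "balanced_M_seq (M h) h s" for s
          proof (rule rgg_contains_balanced[where j = "j h" and h = h])
            show "2 \<le> s i" if "i \<in> {1..h}" for i using s that by (simp add: balanced_M_seq_def)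
            show "\<not> deviates h \<omega> (card (bt_verts s h)) c'" if "c' < k h ^ CARD('d)" for c'
              by (rule not_deviates[OF \<omega> card_bt_verts_balanced[OF s] that])
          qed (use elim jk rb r h1 kh[OF h1] in auto)
          then show "\<omega> \<in> event_E (r h) (M h) h" by (simp add: event_E_def)
        qed
      qed
    qed
  qed
qed

theorem theorem3p1:
  fixes \<epsilon> :: real and M :: "nat \<Rightarrow> nat" and r :: "nat \<Rightarrow> real"
    and d_type :: "'d::finite itself"
  assumes eps: "0 < \<epsilon>" "\<epsilon> < 1"
    and M2: "\<forall>h\<ge>1. 2 \<le> M h"
    and Mo: "(\<lambda>h. real (M h)) \<in> o(\<lambda>h. real h / ln (real h))"
    and rpos: "\<forall>h\<ge>1. 0 < r h"
  shows "((\<forall>h\<ge>1. r h \<le> (1 - \<epsilon>) * (sqrt (real CARD('d)) / (2 * real h))) \<longrightarrow>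
           (\<lambda>h. measure (rgg_space :: (nat \<Rightarrow> real^'d) measure) (event_F (r h) (M h) h))
             \<longlonglongrightarrow> 1)
       \<and> ((\<forall>h\<ge>1. r h \<ge> (1 + \<epsilon>) * (sqrt (real CARD('d)) / (2 * real h))) \<longrightarrow>
           (\<lambda>h. measure (rgg_space :: (nat \<Rightarrow> real^'d) measure) (event_E (r h) (M h) h))
             \<longlonglongrightarrow> 1)"
  using event_F_limit[OF eps(1) rpos] event_E_limit[OF eps] by blast

end
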